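(* Let $N$ be an integer, $1<p<N$, let $A,r,\alpha>0$, and let $u\in D^{1,p}(\mathbb{R}^N)\cap C^{1,\alpha}_{loc}(\mathbb{R}^N)$ satisfy (in the weak sense) $$-\Delta_p u\ge A\ \text{ in }B_r,\qquad -\Delta_p u\ge 0\ \text{ in }\mathbb{R}^N,\qquad u\ge0\ \text{ in }\mathbb{R}^N.$$ Then $u(x)\ge C|x|^{(p-N)/(p-1)}$ for all $|x|>r$, where $$C=\left(\frac{A}{N}\right)^{1/(p-1)}\frac{p-1}{N-p}\,r^{N/(p-1)}.$$
   Context: $B_r$ is the open ball of $\mathbb{R}^N$ of radius $r$ centered at the origin. $\Delta_p u=\mathrm{div}(|\nabla u|^{p-2}\nabla u)$. $D^{1,p}(\mathbb{R}^N)=\{u\in L^{p^*}(\mathbb{R}^N):\nabla u\in L^p(\mathbb{R}^N,\mathbb{R}^N)\}$, where $p^*=\frac{pN}{N-p}$. *)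

theory Defs
  imports "HOL-Analysis.Analysis"
begin

definition grad :: "('a::euclidean_space \<Rightarrow> real) \<Rightarrow> 'a \<Rightarrow> 'a" where
  "grad f x = (THE D. GDERIV f x :> D)"

lemma grad_eqI:
  assumes "GDERIV f x :> D"
  shows "grad f x = D"
  unfolding grad_def
proof (rule the_equality)
  fix E assume "GDERIV f x :> E"
  with assms have "(\<lambda>h. h \<bullet> E) = (\<lambda>h. h \<bullet> D)"
    unfolding gderiv_def by (metis has_derivative_unique)
  then show "E = D"
    by (intro vector_eq_rdot[THEN iffD1]) (metis inner_commute)
qed (rule assms)

lemma differentiable_imp_GDERIV_grad:
  assumes "f differentiable (at x)"
  shows "GDERIV f x :> grad f x"
proof -
  obtain f' where f': "(f has_derivative f') (at x)"
    using assms by (auto simp: differentiable_def)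
  interpret bounded_linear f'
    using f' by (rule has_derivative_bounded_linear)
  have "f' h = h \<bullet> (\<Sum>b\<in>Basis. f' b *\<^sub>R b)" for h
  proof -
    have "f' h = f' (\<Sum>b\<in>Basis. (h \<bullet> b) *\<^sub>R b)"
      by (simp add: euclidean_representation)
    also have "\<dots> = h \<bullet> (\<Sum>b\<in>Basis. f' b *\<^sub>R b)"
      by (simp add: sum scale inner_sum_right mult.commute)
    finally show ?thesis .
  qed
  then have "f' = (\<lambda>h. h \<bullet> (\<Sum>b\<in>Basis. f' b *\<^sub>R b))" by blast
  with f' have "GDERIV f x :> (\<Sum>b\<in>Basis. f' b *\<^sub>R b)"
    unfolding gderiv_def by simp
  with grad_eqI[OF this] show ?thesis by simp
qed

text \<open>
  \<open>C_k k\<close> is the class of k times continuously differentiable functions on the whole space, by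
  recursion on the partial derivatives.
\<close>

primrec C_k :: "nat \<Rightarrow> ('a::euclidean_space \<Rightarrow> real) \<Rightarrow> bool" where
  "C_k 0 f \<longleftrightarrow> continuous_on UNIV f"
| "C_k (Suc k) f \<longleftrightarrow>
    (\<forall>x. f differentiable (at x)) \<and> (\<forall>b\<in>Basis. C_k k (\<lambda>x. grad f x \<bullet> b))"

text \<open>
  \<open>test_functions \<Omega>\<close> is the space of smooth functions with compact support in \<open>\<Omega>\<close>, extended by zero
  to the whole space.
\<close>

definition test_functions :: "'a::euclidean_space set \<Rightarrow> ('a \<Rightarrow> real) set" where
  "test_functions \<Omega> = {\<phi>. (\<forall>k. C_k k \<phi>) \<and>
     compact (closure {x. \<phi> x \<noteq> 0}) \<and> closure {x. \<phi> x \<noteq> 0} \<subseteq> \<Omega>}"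

definition in_Lp :: "real \<Rightarrow> ('a::euclidean_space \<Rightarrow> 'b::euclidean_space) \<Rightarrow> bool" where
  "in_Lp q f \<longleftrightarrow>
    f \<in> borel_measurable lebesgue \<and> integrable lebesgue (\<lambda>x. norm (f x) powr q)"

definition locally_integrable :: "('a::euclidean_space \<Rightarrow> 'b::euclidean_space) \<Rightarrow> bool" where
  "locally_integrable f \<longleftrightarrow> (\<forall>K. compact K \<longrightarrow> set_integrable lebesgue K f)"

definition has_weak_gradient ::
    "('a::euclidean_space \<Rightarrow> real) \<Rightarrow> ('a \<Rightarrow> 'a) \<Rightarrow> bool" where
  "has_weak_gradient u G \<longleftrightarrow> locally_integrable u \<and> locally_integrable G \<and>
    (\<forall>\<phi>\<in>test_functions UNIV.
      (LINT x|lebesgue. u x *\<^sub>R grad \<phi> x) = - (LINT x|lebesgue. \<phi> x *\<^sub>R G x))"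

definition D1p :: "real \<Rightarrow> ('a::euclidean_space \<Rightarrow> real) set" where
  "D1p p = {u. in_Lp (p * real DIM('a) / (real DIM('a) - p)) u \<and>
               (\<exists>G. has_weak_gradient u G \<and> in_Lp p G)}"

definition C1_loc :: "real \<Rightarrow> ('a::euclidean_space \<Rightarrow> real) set" where
  "C1_loc \<alpha> = {u. (\<forall>x. u differentiable (at x)) \<and> continuous_on UNIV (grad u) \<and>
     (\<forall>K. compact K \<longrightarrow>
       (\<exists>L. \<forall>x\<in>K. \<forall>y\<in>K. norm (grad u x - grad u y) \<le> L * dist x y powr \<alpha>))}"

text \<open>
  Weak form of \<open>-\<Delta>\<^sub>p u \<ge> f\<close> in the open set \<open>\<Omega>\<close> for a continuously differentiable \<open>u\<close>, whose weak
  gradient is the classical one. Where the gradient vanishes the integrand on the left is zero,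
  also for \<open>p < 2\<close>.
\<close>

definition weak_minus_p_Laplacian_ge ::
    "real \<Rightarrow> ('a::euclidean_space \<Rightarrow> real) \<Rightarrow> ('a \<Rightarrow> real) \<Rightarrow> 'a set \<Rightarrow> bool" where
  "weak_minus_p_Laplacian_ge p u f \<Omega> \<longleftrightarrow>
    (\<forall>\<phi>\<in>test_functions \<Omega>. (\<forall>x. 0 \<le> \<phi> x) \<longrightarrow>
      (LINT x:\<Omega>|lebesgue. (norm (grad u x) powr (p - 2) *\<^sub>R grad u x) \<bullet> grad \<phi> x)
        \<ge> (LINT x:\<Omega>|lebesgue. f x * \<phi> x))"

end

theory Submission
  imports Defs "HOL-Real_Asymp.Real_Asymp"
begin

text \<open>
  The weak inequalities, given for smooth test functions, extend by mollification to \<open>C\<^sup>1\<close> test functions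
  with compact support. Cutting off inside the ball then combines them into
  \<open>-\<Delta>\<^sub>p u \<ge> A 1\<^bsub>B\<^esub>\<close> on the whole space, where \<open>B\<close> is the ball of radius \<open>r\<close>. The radial solution \<open>v\<close> of
  \<open>-\<Delta>\<^sub>p v = A 1\<^bsub>B\<^esub>\<close> that vanishes at infinity is explicit, and it equals \<open>C |x|\<close> to the power
  \<open>(p - N) / (p - 1)\<close> outside \<open>B\<close>. Since \<open>u \<ge> 0\<close>, the function \<open>f = ((v - u - e)\<^sup>+)\<^sup>2\<close> has compact support for
  every \<open>e > 0\<close>. Testing with \<open>f\<close>, strict monotonicity of \<open>a \<mapsto> |a|\<^sup>p\<^sup>-\<^sup>2 a\<close> forces \<open>\<nabla>f = 0\<close>, hence \<open>f = 0\<close>,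
  that is \<open>v \<le> u + e\<close>.
\<close>

section \<open>Smooth bump functions\<close>

text \<open>The differential inequality is nonlinear in \<open>u\<close> but linear in the test
  function, and this linearity is what lets a test function be split between the ball and the whole
  space. The comparison has to test with a function built from \<open>u\<close>, which is only
  \<open>C1\<close>, so smooth test functions do not suffice. The positive part of
  \<open>v - u - e\<close> has a kink on its zero set; its square is \<open>C1\<close>, and
  mollification closes exactly this gap. The shift \<open>e\<close> is there because
  \<open>v\<close> is positive everywhere, so \<open>u \<ge> 0\<close> alone says nothing about the
  sign of \<open>v - u\<close> far out. The barrier is found from its flux, which should have
  divergence \<open>-A\<close> in the ball and \<open>0\<close> outside. The field \<open>x\<close>
  has divergence \<open>N\<close> and \<open>x / |x|^N\<close> is divergence free, so the flux is
  \<open>-(A / N) x\<close> inside and \<open>-(A / N) r^N x / |x|^N\<close> outside. It is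
  continuous but not differentiable across the sphere. Its divergence is therefore computed weakly,
  through dilations, without boundary terms.\<close>

lemma GDERIV_imp_differentiable: "GDERIV f x :> D \<Longrightarrow> f differentiable (at x)"
  by (auto simp: gderiv_def differentiable_def)

section \<open>Calculus of k times continuously differentiable functions\<close>

lemma C_k_SucI:
  assumes "\<And>x. GDERIV f x :> G x" and "\<And>b. b \<in> Basis \<Longrightarrow> C_k k (\<lambda>x. G x \<bullet> b)"
  shows "C_k (Suc k) f"
proof -
  have "grad f = G" using grad_eqI[OF assms(1)] by blast
  then show ?thesis using assms GDERIV_imp_differentiable[OF assms(1)] by simp
qed

text \<open>Needed for products: the product rule pairs an undifferentiated factor with a derivative
  of the other one, so the orders of the two differ by one.\<close>

lemma C_k_Suc_imp_C_k: "C_k (Suc k) f \<Longrightarrow> C_k k f"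
proof (induction k arbitrary: f)
  case 0
  then show ?case
    by (simp add: continuous_on_eq_continuous_at differentiable_imp_continuous_within)
next
  case (Suc k)
  from Suc.prems have d: "\<forall>x. f differentiable (at x)"
    and "\<forall>b\<in>Basis. C_k (Suc k) (\<lambda>x. grad f x \<bullet> b)"
    by simp_all
  with Suc.IH have "\<forall>b\<in>Basis. C_k k (\<lambda>x. grad f x \<bullet> b)" by blast
  with d show ?case by simp
qed

lemma C_k_const: "C_k k (\<lambda>x. c)"
proof (induction k arbitrary: c)
  case (Suc k)
  show ?case by (rule C_k_SucI[where G="\<lambda>_. 0"]) (use Suc in \<open>simp_all add: GDERIV_const\<close>)
qed simp

lemma C_k_inner: "C_k k (\<lambda>x. x \<bullet> b)"
proof (cases k)
  case (Suc j)
  have "GDERIV (\<lambda>x. x \<bullet> b) x :> b" for x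
    unfolding gderiv_def by (auto intro!: derivative_eq_intros)
  then show ?thesis unfolding Suc by (rule C_k_SucI) (rule C_k_const)
qed (simp add: continuous_on_inner)

lemma C_k_add: "C_k k f \<Longrightarrow> C_k k g \<Longrightarrow> C_k k (\<lambda>x. f x + g x)"
proof (induction k arbitrary: f g)
  case 0
  then show ?case by (simp add: continuous_on_add)
next
  case (Suc k)
  show ?case
  proof (rule C_k_SucI[where G="\<lambda>x. grad f x + grad g x"])
    fix x show "GDERIV (\<lambda>x. f x + g x) x :> grad f x + grad g x"
      using Suc.prems by (intro GDERIV_add differentiable_imp_GDERIV_grad) auto
  next
    fix b :: 'a assume "b \<in> Basis"
    then show "C_k k (\<lambda>x. (grad f x + grad g x) \<bullet> b)"
      unfolding inner_add_left using Suc.prems by (intro Suc.IH) simp_all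
  qed
qed

lemma C_k_mult: "C_k k f \<Longrightarrow> C_k k g \<Longrightarrow> C_k k (\<lambda>x. f x * g x)"
proof (induction k arbitrary: f g)
  case 0
  then show ?case by (simp add: continuous_on_mult)
next
  case (Suc k)
  show ?case
  proof (rule C_k_SucI[where G="\<lambda>x. f x *\<^sub>R grad g x + g x *\<^sub>R grad f x"])
    fix x show "GDERIV (\<lambda>x. f x * g x) x :> f x *\<^sub>R grad g x + g x *\<^sub>R grad f x"
      using Suc.prems by (intro GDERIV_mult differentiable_imp_GDERIV_grad) auto
  next
    fix b :: 'a assume b: "b \<in> Basis"
    have "C_k k (\<lambda>x. f x * (grad g x \<bullet> b) + g x * (grad f x \<bullet> b))"
      using b Suc.prems C_k_Suc_imp_C_k[OF Suc.prems(1)] C_k_Suc_imp_C_k[OF Suc.prems(2)]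
      by (intro C_k_add Suc.IH) simp_all
    then show "C_k k (\<lambda>x. (f x *\<^sub>R grad g x + g x *\<^sub>R grad f x) \<bullet> b)"
      by (simp add: inner_add_left)
  qed
qed

text \<open>The family exp(-1/t) / t^n, extended by zero. The powers are included because
  differentiation leads from \<open>flat n\<close> to \<open>flat (n + 1)\<close> and
  \<open>flat (n + 2)\<close>, which keeps the linear span closed.\<close>

definition flat :: "nat \<Rightarrow> real \<Rightarrow> real" where
  "flat n t = (if t > 0 then exp (- inverse t) * inverse t ^ n else 0)"

lemma flat_nonneg: "0 \<le> flat n t" and flat_pos_iff: "0 < flat n t \<longleftrightarrow> 0 < t"
  by (auto simp: flat_def)

lemma flat_tendsto_0: "(flat n \<longlongrightarrow> 0) (at_right 0)"
proof -
  have "((\<lambda>s::real. s ^ n / exp s) \<longlongrightarrow> 0) at_top"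
    by (rule tendsto_power_div_exp_0)
  then have "((\<lambda>t::real. inverse t ^ n / exp (inverse t)) \<longlongrightarrow> 0) (at_right 0)"
    by (rule filterlim_compose) (rule filterlim_inverse_at_top_right)
  moreover have "eventually (\<lambda>t. inverse t ^ n / exp (inverse t) = flat n t) (at_right 0)"
    unfolding eventually_at_right_field
    by (intro exI[of _ 1]) (auto simp: flat_def exp_minus divide_inverse mult_ac)
  ultimately show ?thesis by (rule Lim_transform_eventually)
qed

lemma DERIV_flat: "DERIV (flat n) t :> flat (n + 2) t - real n * flat (n + 1) t"
proof (cases t "0::real" rule: linorder_cases)
  case less
  have "DERIV (\<lambda>_. 0) t :> (0::real)" by simp
  then have "DERIV (flat n) t :> 0"
    by (rule has_field_derivative_transform_within_open[where S="{..<0}"])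
      (use less in \<open>auto simp: flat_def\<close>)
  with less show ?thesis by (simp add: flat_def)
next
  case greater
  have "DERIV (\<lambda>t. inverse t ^ n) t :> - (real n * inverse t ^ (n + 1))"
  proof (cases n)
    case (Suc m)
    show ?thesis
      using DERIV_power_Suc[OF DERIV_inverse, of t m] greater Suc
      by (simp add: algebra_simps)
  qed simp
  moreover have "DERIV (\<lambda>t. exp (- inverse t)) t :> exp (- inverse t) * inverse t ^ 2"
    using greater by (auto intro!: derivative_eq_intros simp: power2_eq_square)
  ultimately have "DERIV (\<lambda>t. exp (- inverse t) * inverse t ^ n) t :>
      exp (- inverse t) * inverse t ^ 2 * inverse t ^ n
      + - (real n * inverse t ^ (n + 1)) * exp (- inverse t)"
    by (intro DERIV_mult)
  then have "DERIV (\<lambda>t. exp (- inverse t) * inverse t ^ n) t :>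
      flat (n + 2) t - real n * flat (n + 1) t"
    using greater by (simp add: flat_def power_add algebra_simps power2_eq_square)
  then show ?thesis
    by (rule has_field_derivative_transform_within_open[where S="{0<..}"])
      (use greater in \<open>auto simp: flat_def\<close>)
next
  case equal
  have "((\<lambda>y. (flat n y - flat n 0) / (y - 0)) \<longlongrightarrow> 0) (at_left 0)"
    by (rule Lim_transform_eventually[OF tendsto_const])
      (auto simp: eventually_at_left_field flat_def intro!: exI[of _ "-1"])
  \<comment> \<open>For \<open>y > 0\<close> the quotient \<open>flat n y / y\<close> is
    \<open>flat (Suc n) y\<close>: the division is absorbed into the index.\<close>
  moreover have "((\<lambda>y. (flat n y - flat n 0) / (y - 0)) \<longlongrightarrow> 0) (at_right 0)"
    by (rule Lim_transform_eventually[OF flat_tendsto_0[of "Suc n"]])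
      (auto simp: eventually_at_right_field flat_def divide_inverse mult_ac intro!: exI[of _ 1])
  ultimately have "DERIV (flat n) 0 :> 0"
    unfolding has_field_derivative_iff by (rule filterlim_split_at)
  with equal show ?thesis by (simp add: flat_def)
qed

text \<open>The standard kernel exp(-1/(d^2 - |x|^2)) on the ball of radius \<open>d\<close>, not
  normalised. The squared norm is used because it is smooth at the origin as well.\<close>

definition bump :: "real \<Rightarrow> 'a::euclidean_space \<Rightarrow> real" where
  "bump d x = flat 0 (d\<^sup>2 - x \<bullet> x)"

text \<open>The induction keeps \<open>n\<close> arbitrary: a gradient consists of members of the
  same family with larger index, multiplied by a linear factor.\<close>

lemma C_k_flat_inner: "C_k k (\<lambda>x::'a::euclidean_space. flat n (d - x \<bullet> x))"
proof (induction k arbitrary: n)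
  case 0
  have "continuous_on UNIV (flat n)"
    using DERIV_flat by (intro DERIV_continuous_on) (auto intro: has_field_derivative_at_within)
  then have "continuous_on UNIV (\<lambda>x::'a. flat n (d - x \<bullet> x))"
    by (rule continuous_on_compose2) (intro continuous_intros, simp)
  then show ?case by simp
next
  case (Suc k)
  let ?d = "\<lambda>x::'a. flat (n + 2) (d - x \<bullet> x) - real n * flat (n + 1) (d - x \<bullet> x)"
  show ?case
  proof (rule C_k_SucI[where G="\<lambda>x. ?d x *\<^sub>R (- 2 *\<^sub>R x)"])
    fix x :: 'a
    have "GDERIV (\<lambda>x. d - x \<bullet> x) x :> - 2 *\<^sub>R x"
      unfolding gderiv_def
      by (auto intro!: derivative_eq_intros simp: inner_commute algebra_simps)
    then show "GDERIV (\<lambda>x. flat n (d - x \<bullet> x)) x :> ?d x *\<^sub>R (- 2 *\<^sub>R x)"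
      using DERIV_flat by (rule GDERIV_DERIV_compose)
  next
    fix b :: 'a
    have "C_k k (\<lambda>x. (flat (n + 2) (d - x \<bullet> x) + (- real n) * flat (n + 1) (d - x \<bullet> x))
      * (-2 * (x \<bullet> b)))"
      by (intro C_k_mult C_k_add C_k_const C_k_inner Suc.IH)
    then show "C_k k (\<lambda>x. (?d x *\<^sub>R (- 2 *\<^sub>R x)) \<bullet> b)" by (simp add: algebra_simps)
  qed
qed

lemma C_k_bump: "C_k k (bump d)"
  using C_k_flat_inner[of k 0 "d\<^sup>2"] by (simp add: bump_def[abs_def])

lemma bump_nonneg: "0 \<le> bump d x"
  by (simp add: bump_def flat_nonneg)

lemma bump_pos_iff: "0 < d \<Longrightarrow> 0 < bump d x \<longleftrightarrow> norm x < d"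
  using power2_less_imp_less[of "norm x" d] power_strict_mono[of "norm x" d 2]
  by (auto simp: bump_def flat_pos_iff simp flip: power2_norm_eq_inner)

section \<open>Convolution\<close>

definition C1 :: "('a::euclidean_space \<Rightarrow> real) \<Rightarrow> bool" where
  "C1 f \<longleftrightarrow> (\<forall>x. f differentiable (at x)) \<and> continuous_on UNIV (grad f)"

lemma C1I:
  assumes "\<And>x. GDERIV f x :> G x" and "continuous_on UNIV G"
  shows "C1 f" and "grad f = G"
proof -
  show "grad f = G" using grad_eqI[OF assms(1)] by blast
  with assms show "C1 f"
    using GDERIV_imp_differentiable[OF assms(1)] by (simp add: C1_def)
qed

lemma C1_GDERIV: "C1 f \<Longrightarrow> GDERIV f x :> grad f x"
  by (simp add: C1_def differentiable_imp_GDERIV_grad)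

lemma C1_continuous_grad: "C1 f \<Longrightarrow> continuous_on S (grad f)"
  unfolding C1_def by (blast intro: continuous_on_subset)

lemma C1_continuous: "C1 f \<Longrightarrow> continuous_on S f"
  by (simp add: C1_def continuous_at_imp_continuous_on differentiable_imp_continuous_within)

lemma GDERIV_zero_outside:
  assumes "\<And>x. x \<notin> K \<Longrightarrow> f x = 0" and "closed K" and "x \<notin> K"
  shows "GDERIV f x :> 0"
proof -
  have "((\<lambda>_. 0) has_derivative (\<lambda>h. h \<bullet> 0)) (at x)" by simp
  then show ?thesis unfolding gderiv_def
    by (rule has_derivative_transform_within_open[where s="- K"]) (use assms in auto)
qed

lemma grad_zero_outside:
  assumes "\<And>x. x \<notin> K \<Longrightarrow> f x = 0" and "closed K" and "x \<notin> K"
  shows "grad f x = 0"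
  using GDERIV_zero_outside[OF assms] by (rule grad_eqI)

section \<open>Integrals of continuous functions with compact support, and their
  differentiation\<close>

lemma integrable_continuous_compact_support:
  fixes f :: "'a::euclidean_space \<Rightarrow> 'b::euclidean_space"
  assumes "continuous_on UNIV f" and "compact K" and "\<And>x. x \<notin> K \<Longrightarrow> f x = 0"
  shows "integrable lborel f"
proof -
  have "integrable lborel (\<lambda>x. indicator K x *\<^sub>R f x)"
    using assms by (intro borel_integrable_compact) (auto intro: continuous_on_subset)
  also have "(\<lambda>x. indicator K x *\<^sub>R f x) = f"
    using assms(3) by (auto simp: indicator_def)
  finally show ?thesis .
qed

lemma LINT_lborel_eq_integral_cbox:
  fixes f :: "'a::euclidean_space \<Rightarrow> 'b::euclidean_space"
  assumes "continuous_on UNIV f" and "\<And>x. x \<notin> cbox a b \<Longrightarrow> f x = 0"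
  shows "(LINT x|lborel. f x) = integral (cbox a b) f"
proof -
  have "(LINT x|lborel. f x) = integral UNIV f"
    using integrable_continuous_compact_support[OF assms(1) compact_cbox assms(2)]
    by (simp add: integral_lborel)
  also have "integral UNIV f = integral UNIV (\<lambda>x. if x \<in> cbox a b then f x else 0)"
    using assms(2) by (intro integral_cong) auto
  also have "\<dots> = integral (cbox a b) f"
    by (rule Henstock_Kurzweil_Integration.integral_restrict_UNIV)
  finally show ?thesis .
qed

text \<open>The set where a continuous function is nonzero is open, and an open null set is empty;
  this upgrades almost everywhere to everywhere.\<close>

lemma LINT_zero_imp_zero:
  fixes f :: "'a::euclidean_space \<Rightarrow> real"
  assumes cont: "continuous_on UNIV f" and "compact K" and zero: "\<And>x. x \<notin> K \<Longrightarrow> f x = 0"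
    and nonneg: "\<And>x. 0 \<le> f x" and le: "(LINT x|lborel. f x) \<le> 0"
  shows "f x = 0"
proof -
  have int: "integrable lborel f"
    using integrable_continuous_compact_support assms by blast
  have "AE x in lborel. f x = 0"
    using integral_nonneg_eq_0_iff_AE[OF int] nonneg le Bochner_Integration.integral_nonneg[of lborel f]
    by (simp add: order_antisym)
  moreover have op: "open (f -` (- {0}))"
    using cont by (intro open_vimage) auto
  ultimately have "f -` (- {0}) \<in> null_sets lborel"
    using borel_open[OF op] by (subst AE_iff_null_sets) (auto simp: vimage_def)
  with op have "f -` (- {0}) = {}"
    using open_not_negligible[of "f -` (- {0})"]
    by (metis negligible_iff_null_sets null_sets_completionI)
  then show ?thesis by auto
qed

lemma LINT_lborel_affine:
  fixes f :: "'a::euclidean_space \<Rightarrow> 'b::{banach, second_countable_topology}"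
  assumes [measurable]: "f \<in> borel_measurable borel" and "c \<noteq> 0"
  shows "(LINT x|lborel. f x) = \<bar>c\<bar> ^ DIM('a) *\<^sub>R (LINT x|lborel. f (t + c *\<^sub>R x))"
  by (subst lborel_affine[OF assms(2), of t])
    (simp add: integral_density integral_distr)

lemma LINT_lborel_reflect:
  fixes f :: "'a::euclidean_space \<Rightarrow> 'b::{banach, second_countable_topology}"
  assumes "f \<in> borel_measurable borel"
  shows "(LINT y|lborel. f (x - y)) = (LINT y|lborel. f y)"
  using LINT_lborel_affine[OF assms, of "-1" x] by simp

text \<open>Leibniz rule on a fixed box. Differentiation falls on \<open>H\<close> alone, so
  \<open>h\<close> need only be continuous; either factor of a mollification can take either
  role.\<close>

lemma GDERIV_convolution:
  fixes H :: "'a::euclidean_space \<Rightarrow> real"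
  assumes h: "continuous_on (cbox a b) h" and H: "C1 H"
  shows "GDERIV (\<lambda>x. integral (cbox a b) (\<lambda>t. h t * H (x - t))) x :>
    integral (cbox a b) (\<lambda>t. h t *\<^sub>R grad H (x - t))"
proof -
  note [continuous_intros] = continuous_on_compose2[OF C1_continuous[OF H, of UNIV]]
    continuous_on_compose2[OF C1_continuous_grad[OF H, of UNIV]]
  have cont: "continuous_on (cbox a b) (\<lambda>t. h t *\<^sub>R grad H (x - t))"
    by (intro continuous_intros h) auto
  let ?D = "\<lambda>x t. blinfun_inner_left (h t *\<^sub>R grad H (x - t))"
  have contD: "continuous_on (UNIV \<times> cbox a b) (\<lambda>(x, t). ?D x t)"
    unfolding split_beta
    by (intro continuous_intros continuous_on_compose2[OF h]) auto
  have "((\<lambda>x. integral (cbox a b) (\<lambda>t. h t * H (x - t))) has_derivative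
      blinfun_apply (integral (cbox a b) (?D x))) (at x)"
  proof (rule leibniz_rule[where U=UNIV])
    fix x t
    have "(H has_derivative (\<lambda>v. v \<bullet> grad H (x - t))) (at (x - t))"
      using C1_GDERIV[OF H] by (simp add: gderiv_def)
    then have "((\<lambda>x. H (x - t)) has_derivative (\<lambda>v. v \<bullet> grad H (x - t))) (at x)"
      by (rule has_derivative_compose[rotated]) (auto intro!: derivative_eq_intros)
    then have "((\<lambda>x. h t * H (x - t)) has_derivative (\<lambda>v. h t * (v \<bullet> grad H (x - t)))) (at x)"
      by (rule has_derivative_mult_right)
    then show "((\<lambda>x. h t * H (x - t)) has_derivative blinfun_apply (?D x t)) (at x)"
      by simp
  next
    fix x show "(\<lambda>t. h t * H (x - t)) integrable_on cbox a b"
      by (intro integrable_continuous continuous_intros h) auto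
  qed (use contD in auto)
  \<comment> \<open>The rule delivers an integral of linear functionals. Evaluating at
    \<open>v\<close> and taking the inner product out of the integral recovers the gradient
    vector.\<close>
  also have "blinfun_apply (integral (cbox a b) (?D x)) =
      (\<lambda>v. v \<bullet> integral (cbox a b) (\<lambda>t. h t *\<^sub>R grad H (x - t)))"
  proof
    fix v
    have "blinfun_apply (integral (cbox a b) (?D x)) v = integral (cbox a b) (\<lambda>t. ?D x t v)"
      by (intro blinfun_apply_integral integrable_continuous continuous_intros h) auto
    also have "\<dots> = integral (cbox a b) ((\<lambda>w. v \<bullet> w) \<circ> (\<lambda>t. h t *\<^sub>R grad H (x - t)))"
      by (simp add: o_def)
    also have "\<dots> = v \<bullet> integral (cbox a b) (\<lambda>t. h t *\<^sub>R grad H (x - t))"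
      using integrable_continuous[OF cont] bounded_linear_inner_right by (rule integral_linear)
    finally show "blinfun_apply (integral (cbox a b) (?D x)) v =
      v \<bullet> integral (cbox a b) (\<lambda>t. h t *\<^sub>R grad H (x - t))" .
  qed
  finally show ?thesis by (simp add: gderiv_def)
qed

lemma C1_if_C_k:
  assumes "C_k (Suc 0) f" shows "C1 f"
proof -
  have "continuous_on UNIV (\<lambda>x. \<Sum>b\<in>Basis. (grad f x \<bullet> b) *\<^sub>R b)"
    using assms by (intro continuous_on_sum continuous_on_scaleR continuous_on_const) auto
  then have "continuous_on UNIV (grad f)"
    unfolding euclidean_representation .
  with assms show ?thesis by (simp add: C1_def)
qed

text \<open>The partial derivatives of \<open>H\<close> again satisfy the hypothesis for every
  order, so the induction runs with \<open>H\<close> arbitrary while \<open>h\<close> is never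
  differentiated.\<close>

lemma C_k_convolution:
  fixes H :: "'a::euclidean_space \<Rightarrow> real"
  assumes h: "continuous_on (cbox a b) h" and "\<And>k. C_k k H"
  shows "C_k k (\<lambda>x. integral (cbox a b) (\<lambda>t. h t * H (x - t)))"
  using assms(2)
proof (induction k arbitrary: H)
  case 0
  have "C1 H" using 0[of "Suc 0"] by (rule C1_if_C_k)
  from GDERIV_convolution[OF h this, THEN GDERIV_imp_differentiable]
  show ?case by (simp add: continuous_on_eq_continuous_at differentiable_imp_continuous_within)
next
  case (Suc k)
  have C1: "C1 H" using Suc.prems[of "Suc 0"] by (rule C1_if_C_k)
  have part: "C_k j (\<lambda>x. grad H x \<bullet> e)" if "e \<in> Basis" for e j
    using Suc.prems[of "Suc j"] that by simp
  show ?case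
  proof (rule C_k_SucI[OF GDERIV_convolution[OF h C1]])
    fix e :: 'a assume e: "e \<in> Basis"
    have "integral (cbox a b) (\<lambda>t. h t *\<^sub>R grad H (x - t)) \<bullet> e =
      integral (cbox a b) (\<lambda>t. h t * (grad H (x - t) \<bullet> e))" for x
    proof -
      have "(\<lambda>t. h t *\<^sub>R grad H (x - t)) integrable_on cbox a b"
        by (intro integrable_continuous continuous_intros h
            continuous_on_compose2[OF C1_continuous_grad[OF C1, of UNIV]]) auto
      from integral_linear[OF this bounded_linear_inner_left[of e]]
      show ?thesis by (simp add: o_def)
    qed
    with Suc.IH[OF part[OF e]]
    show "C_k k (\<lambda>x. integral (cbox a b) (\<lambda>t. h t *\<^sub>R grad H (x - t)) \<bullet> e)"
      by simp
  qed
qed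

section \<open>Mollification\<close>

lemma continuous_bump: "continuous_on S (bump d)"
  using C_k_bump[of 0 d] continuous_on_subset[of UNIV "bump d" S] by simp

lemma bump_outside: "0 < d \<Longrightarrow> y \<notin> cball 0 d \<Longrightarrow> bump d y = 0"
  using bump_pos_iff[of d y] bump_nonneg[of d y] by simp

lemma integrable_bump_scaleR:
  fixes g :: "'a::euclidean_space \<Rightarrow> 'b::euclidean_space"
  assumes "0 < d" and "continuous_on UNIV g"
  shows "integrable lborel (\<lambda>y. bump d y *\<^sub>R g y)"
  using assms
  by (intro integrable_continuous_compact_support[where K="cball 0 d"] continuous_on_scaleR
      continuous_bump) (simp_all add: bump_outside)

lemma integrable_bump: "0 < d \<Longrightarrow> integrable lborel (bump d)"
  using integrable_bump_scaleR[of d "\<lambda>_. 1::real"] by simp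

lemma LINT_bump_pos:
  assumes "0 < d"
  shows "0 < (LINT y|lborel. bump d (y::'a::euclidean_space))"
proof (rule ccontr)
  assume "\<not> ?thesis"
  then have "bump d (0::'a) = 0"
    using LINT_zero_imp_zero[OF continuous_bump compact_cball bump_outside[OF assms] bump_nonneg]
    by (metis linorder_not_le nle_le)
  with bump_pos_iff[OF assms, of "0::'a"] assms show False by simp
qed

text \<open>A weighted average over the ball of radius \<open>d\<close> around \<open>x\<close>.
  Vector values are allowed because gradients are mollified too.\<close>

definition mollify ::
    "real \<Rightarrow> ('a::euclidean_space \<Rightarrow> 'b::euclidean_space) \<Rightarrow> 'a \<Rightarrow> 'b" where
  "mollify d g x = (LINT y|lborel. bump d y *\<^sub>R g (x - y)) /\<^sub>R (LINT y|lborel. bump d (y::'a))"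

lemma continuous_on_reflect:
  fixes g :: "'a::euclidean_space \<Rightarrow> 'b::euclidean_space"
  assumes "continuous_on UNIV g" shows "continuous_on S (\<lambda>y. g (x - y))"
  by (rule continuous_on_compose2[OF assms]) (intro continuous_intros, simp)

text \<open>A weighted average stays in every closed ball containing the averaged values. This one
  estimate gives the pointwise limit, the uniform bound and, with \<open>e = 0\<close>, the
  vanishing away from the support.\<close>

lemma mollify_near:
  fixes g :: "'a::euclidean_space \<Rightarrow> 'b::euclidean_space"
  assumes d: "0 < d" and g: "continuous_on UNIV g"
    and near: "\<And>y. norm y \<le> d \<Longrightarrow> norm (g (x - y) - w) \<le> e"
  shows "norm (mollify d g x - w) \<le> e"
proof -
  define c where "c = (LINT y|lborel. bump d (y::'a))"
  have c: "0 < c" unfolding c_def using d by (rule LINT_bump_pos)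
  note int = integrable_bump_scaleR[OF d continuous_on_reflect[OF g]]
  have "c *\<^sub>R (mollify d g x - w) = (LINT y|lborel. bump d y *\<^sub>R g (x - y)) - c *\<^sub>R w"
    using c by (simp add: mollify_def scaleR_diff_right flip: c_def)
  also have "c *\<^sub>R w = (LINT y|lborel. bump d (y::'a) *\<^sub>R w)"
    unfolding c_def using integrable_bump[OF d, where 'a='a] by simp
  also have "(LINT y|lborel. bump d y *\<^sub>R g (x - y)) - \<dots> =
      (LINT y|lborel. bump d y *\<^sub>R (g (x - y) - w))"
    using int integrable_bump[OF d, where 'a='a] by (simp add: scaleR_diff_right)
  finally have "norm (c *\<^sub>R (mollify d g x - w)) =
      norm (LINT y|lborel. bump d y *\<^sub>R (g (x - y) - w))"
    by (rule arg_cong)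
  then have "c * norm (mollify d g x - w) =
      norm (LINT y|lborel. bump d y *\<^sub>R (g (x - y) - w))"
    using c by simp
  also have "\<dots> \<le> (LINT y|lborel. norm (bump d y *\<^sub>R (g (x - y) - w)))"
    by (rule integral_norm_bound)
  also have "\<dots> \<le> (LINT y|lborel. bump d (y::'a) * e)"
  proof (rule Bochner_Integration.integral_mono)
    show "integrable lborel (\<lambda>y. norm (bump d y *\<^sub>R (g (x - y) - w)))"
      using int integrable_bump[OF d, where 'a='a] by (intro integrable_norm) (simp add: scaleR_diff_right)
    show "integrable lborel (\<lambda>y. bump d (y::'a) * e)"
      using integrable_bump[OF d, where 'a='a] by simp
    fix y :: 'a
    show "norm (bump d y *\<^sub>R (g (x - y) - w)) \<le> bump d y * e"
      using near[of y] bump_outside[OF d, of y] bump_nonneg[of d y]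
      by (cases "norm y \<le> d") (auto intro: mult_left_mono)
  qed
  also have "\<dots> = c * e"
    unfolding c_def using integrable_bump[OF d, where 'a='a] by simp
  finally show ?thesis using c by simp
qed

lemma mollify_nonneg:
  fixes f :: "'a::euclidean_space \<Rightarrow> real"
  assumes "0 < d" and "\<And>x. 0 \<le> f x"
  shows "0 \<le> mollify d f x"
proof -
  have "0 \<le> (LINT y|lborel. bump d y *\<^sub>R f (x - y))"
    by (intro Bochner_Integration.integral_nonneg) (simp add: assms(2) bump_nonneg)
  with LINT_bump_pos[OF assms(1), where 'a='a] show ?thesis
    by (simp add: mollify_def)
qed

text \<open>Convolution with the bump as \<open>h\<close> and \<open>f\<close> as \<open>H\<close>:
  the derivative falls on \<open>f\<close>.\<close>

lemma GDERIV_mollify: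
  fixes f :: "'a::euclidean_space \<Rightarrow> real"
  assumes d: "0 < d" and f: "C1 f"
  shows "GDERIV (mollify d f) x :> mollify d (grad f) x"
proof -
  define c where "c = (LINT y|lborel. bump d (y::'a))"
  obtain b :: 'a where b: "cball 0 d \<subseteq> cbox (- b) b"
    using bounded_subset_cbox_symmetric[OF bounded_cball] by blast
  have eq: "mollify d g x = integral (cbox (- b) b) (\<lambda>y. bump d y *\<^sub>R g (x - y)) /\<^sub>R c"
    if g: "continuous_on UNIV g" for g :: "'a \<Rightarrow> 'c::euclidean_space" and x
  proof -
    have "(LINT y|lborel. bump d y *\<^sub>R g (x - y)) =
      integral (cbox (- b) b) (\<lambda>y. bump d y *\<^sub>R g (x - y))"
    proof (rule LINT_lborel_eq_integral_cbox)
      show "continuous_on UNIV (\<lambda>y. bump d y *\<^sub>R g (x - y))"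
        by (intro continuous_on_scaleR continuous_bump continuous_on_reflect g)
      show "bump d y *\<^sub>R g (x - y) = 0" if "y \<notin> cbox (- b) b" for y
        using that b bump_outside[OF d, of y] by (metis scaleR_zero_left subsetD)
    qed
    then show ?thesis by (simp add: mollify_def c_def)
  qed
  have "GDERIV (\<lambda>x. inverse c * integral (cbox (- b) b) (\<lambda>y. bump d y * f (x - y))) x :>
    inverse c *\<^sub>R integral (cbox (- b) b) (\<lambda>y. bump d y *\<^sub>R grad f (x - y)) +
    integral (cbox (- b) b) (\<lambda>y. bump d y * f (x - y)) *\<^sub>R 0"
    by (intro GDERIV_mult GDERIV_const GDERIV_convolution continuous_bump f)
  then show ?thesis
    using eq[OF C1_continuous_grad[OF f]] eq[OF C1_continuous[OF f], abs_def] by simp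
qed

text \<open>After the reflection of the variable the roles are exchanged: the derivatives fall on
  the bump, so continuity of \<open>f\<close> is enough.\<close>

lemma C_k_mollify:
  fixes f :: "'a::euclidean_space \<Rightarrow> real"
  assumes d: "0 < d" and f: "continuous_on UNIV f" and K: "compact K" "\<And>x. x \<notin> K \<Longrightarrow> f x = 0"
  shows "C_k k (mollify d f)"
proof -
  define c where "c = (LINT y|lborel. bump d (y::'a))"
  obtain b :: 'a where b: "K \<subseteq> cbox (- b) b"
    using bounded_subset_cbox_symmetric[OF compact_imp_bounded[OF K(1)]] by blast
  have "mollify d f = (\<lambda>x. inverse c * integral (cbox (- b) b) (\<lambda>z. f z * bump d (x - z)))"
  proof
    fix x
    have cont: "continuous_on UNIV (\<lambda>z. f z * bump d (x - z))"
      by (intro continuous_on_mult f continuous_on_reflect continuous_bump)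
    then have "(LINT y|lborel. f (x - y) * bump d (x - (x - y))) =
        (LINT z|lborel. f z * bump d (x - z))"
      by (intro LINT_lborel_reflect borel_measurable_continuous_onI)
    also have "\<dots> = integral (cbox (- b) b) (\<lambda>z. f z * bump d (x - z))"
      using b K by (intro LINT_lborel_eq_integral_cbox cont) auto
    finally show "mollify d f x = inverse c * integral (cbox (- b) b) (\<lambda>z. f z * bump d (x - z))"
      by (simp add: mollify_def c_def mult.commute)
  qed
  moreover have "C_k k (\<lambda>x. inverse c * integral (cbox (- b) b) (\<lambda>z. f z * bump d (x - z)))"
    by (intro C_k_mult C_k_const C_k_convolution C_k_bump continuous_on_subset[OF f]) simp
  ultimately show ?thesis by simp
qed

lemma continuous_compact_support_bounded:
  fixes g :: "'a::euclidean_space \<Rightarrow> 'b::euclidean_space"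
  assumes "continuous_on UNIV g" and "compact K" and "\<And>x. x \<notin> K \<Longrightarrow> g x = 0"
  obtains B where "0 \<le> B" "\<And>x. norm (g x) \<le> B"
proof -
  have "bounded (g ` K)"
    using compact_continuous_image[OF continuous_on_subset[OF assms(1)] assms(2)]
    by (simp add: compact_imp_bounded)
  then obtain B where B: "0 < B" "\<forall>y\<in>g ` K. norm y \<le> B"
    unfolding bounded_pos by blast
  then have "norm (g x) \<le> B" for x
    using assms(3)[of x] by (cases "x \<in> K") auto
  with B(1) show thesis by (intro that[of B]) simp_all
qed

lemma mollify_tendsto:
  fixes g :: "'a::euclidean_space \<Rightarrow> 'b::euclidean_space"
  assumes g: "continuous_on UNIV g" and d: "\<And>n. 0 < d n" "d \<longlonglongrightarrow> 0"
  shows "(\<lambda>n. mollify (d n) g x) \<longlonglongrightarrow> g x"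
proof (rule LIMSEQ_I)
  fix e :: real assume e: "0 < e"
  have "isCont g x" using g by (simp add: continuous_on_eq_continuous_at)
  then obtain s where s: "0 < s" "\<And>y. norm (y - x) < s \<Longrightarrow> norm (g y - g x) < e / 2"
    using e unfolding continuous_at_eps_delta dist_norm by (metis half_gt_zero)
  have "eventually (\<lambda>n. d n < s) sequentially"
    using d(2) s(1) by (rule order_tendstoD)
  then obtain n0 where n0: "\<And>n. n \<ge> n0 \<Longrightarrow> d n < s"
    unfolding eventually_sequentially by blast
  have "norm (mollify (d n) g x - g x) < e" if "n \<ge> n0" for n
  proof -
    have "norm (mollify (d n) g x - g x) \<le> e / 2"
    proof (rule mollify_near[OF d(1) g])
      fix y :: 'a assume "norm y \<le> d n"
      with n0[OF that] s(2)[of "x - y"] show "norm (g (x - y) - g x) \<le> e / 2" by simp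
    qed
    with e show ?thesis by simp
  qed
  then show "\<exists>n0. \<forall>n\<ge>n0. norm (mollify (d n) g x - g x) < e" by blast
qed

text \<open>Dominated convergence, with majorant \<open>norm (F x) * B\<close> on the common support
  \<open>L\<close>. The inner product form serves gradients and, with \<open>F\<close> constant,
  scalar functions.\<close>

lemma LINT_mollify_tendsto:
  fixes g F :: "'a::euclidean_space \<Rightarrow> 'b::euclidean_space"
  assumes g: "continuous_on UNIV g" and K: "compact K" "\<And>x. x \<notin> K \<Longrightarrow> g x = 0"
    and F: "continuous_on UNIV F" and d: "\<And>n. 0 < d n" "d \<longlonglongrightarrow> 0"
    and L: "compact L" "\<And>n x. x \<notin> L \<Longrightarrow> mollify (d n) g x = 0"
    and cont: "\<And>n. continuous_on UNIV (mollify (d n) g)"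
  shows "(\<lambda>n. LINT x|lborel. F x \<bullet> mollify (d n) g x) \<longlonglongrightarrow> (LINT x|lborel. F x \<bullet> g x)"
proof -
  obtain B where B: "\<And>x. norm (g x) \<le> B"
    using continuous_compact_support_bounded[OF g K] by metis
  show ?thesis
  proof (rule integral_dominated_convergence[where w="\<lambda>x. indicator L x *\<^sub>R (norm (F x) * B)"])
    show "(\<lambda>x. F x \<bullet> g x) \<in> borel_measurable lborel"
      using F g by (simp add: borel_measurable_continuous_onI continuous_on_inner)
    show "(\<lambda>x. F x \<bullet> mollify (d n) g x) \<in> borel_measurable lborel" for n
      using F cont by (simp add: borel_measurable_continuous_onI continuous_on_inner)
    show "integrable lborel (\<lambda>x. indicator L x *\<^sub>R (norm (F x) * B))"
      by (intro borel_integrable_compact L(1) continuous_intros continuous_on_subset[OF F]) simp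
    show "AE x in lborel. (\<lambda>n. F x \<bullet> mollify (d n) g x) \<longlonglongrightarrow> F x \<bullet> g x"
      by (intro AE_I2 tendsto_inner tendsto_const mollify_tendsto g d)
    show "AE x in lborel. norm (F x \<bullet> mollify (d n) g x) \<le> indicator L x *\<^sub>R (norm (F x) * B)" for n
    proof (intro AE_I2)
      fix x
      have "norm (mollify (d n) g x - 0) \<le> B"
        using B by (intro mollify_near[OF d(1) g]) simp
      then have "norm (F x \<bullet> mollify (d n) g x) \<le> norm (F x) * B"
        using Cauchy_Schwarz_ineq2[of "F x" "mollify (d n) g x"]
          mult_left_mono[OF _ norm_ge_zero[of "F x"]] by (metis diff_zero order_trans real_norm_def)
      then show "norm (F x \<bullet> mollify (d n) g x) \<le> indicator L x *\<^sub>R (norm (F x) * B)"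
        using L(2)[of x n] by (cases "x \<in> L") simp_all
    qed
  qed
qed

lemma weak_inequality_C1:
  fixes F :: "'a::euclidean_space \<Rightarrow> 'a" and f :: "'a \<Rightarrow> real"
  assumes weak: "\<And>\<phi>. \<phi> \<in> test_functions \<Omega> \<Longrightarrow> \<forall>x. 0 \<le> \<phi> x \<Longrightarrow>
      c * (LINT x|lborel. \<phi> x) \<le> (LINT x|lborel. F x \<bullet> grad \<phi> x)"
    and F: "continuous_on UNIV F" and "open \<Omega>"
    and f: "C1 f" "\<And>x. 0 \<le> f x" and K: "compact K" "K \<subseteq> \<Omega>" "\<And>x. x \<notin> K \<Longrightarrow> f x = 0"
  shows "c * (LINT x|lborel. f x) \<le> (LINT x|lborel. F x \<bullet> grad f x)"
proof -
  \<comment> \<open>The room between \<open>K\<close> and the complement of \<open>\<Omega>\<close>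
    bounds all mollification radii, so one compact \<open>L\<close> inside \<open>\<Omega>\<close>
    contains all supports.\<close>
  obtain r where r: "0 < r" "(\<Union>x\<in>K. cball x r) \<subseteq> \<Omega>"
    using compact_subset_open_imp_cball_epsilon_subset[OF K(1) \<open>open \<Omega>\<close> K(2)] by blast
  define d where "d n = r / Suc n" for n
  have d: "0 < d n" "d n \<le> r" for n
    using r(1) by (auto simp: d_def field_simps)
  have d0: "d \<longlonglongrightarrow> 0"
    unfolding d_def by (rule LIMSEQ_Suc[OF lim_const_over_n])
  define L where "L = (\<Union>x\<in>K. \<Union>y\<in>cball 0 r. {x + y})"
  have L: "compact L"
    unfolding L_def by (intro compact_sums' K(1) compact_cball)
  have "L \<subseteq> \<Omega>"
  proof -
    have "L \<subseteq> (\<Union>x\<in>K. cball x r)"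
      unfolding L_def by (auto simp: dist_norm)
    with r(2) show ?thesis by blast
  qed
  have outside: "mollify (d n) g x = 0"
    if g: "continuous_on UNIV g" "\<And>x. x \<notin> K \<Longrightarrow> g x = 0" and x: "x \<notin> L"
    for g :: "'a \<Rightarrow> 'c::euclidean_space" and x n
  proof -
    have "norm (mollify (d n) g x - 0) \<le> 0"
    proof (rule mollify_near[OF d(1) g(1)])
      fix y :: 'a assume y: "norm y \<le> d n"
      have "x - y \<notin> K"
      proof
        assume "x - y \<in> K"
        moreover have "y \<in> cball 0 r" using y d(2)[of n] by simp
        ultimately have "(x - y) + y \<in> L" unfolding L_def by blast
        with x show False by simp
      qed
      with g(2) show "norm (g (x - y) - 0) \<le> 0" by simp
    qed
    then show ?thesis by simp
  qed
  have grad0: "grad f x = 0" if "x \<notin> K" for x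
    using K that by (intro grad_zero_outside[of K]) (auto simp: compact_imp_closed)
  note f_cont = C1_continuous[OF f(1), of UNIV] and grad_cont = C1_continuous_grad[OF f(1), of UNIV]
  have Ck: "C_k k (mollify (d n) f)" for k n
    using K by (intro C_k_mollify d f_cont)
  have grad: "grad (mollify (d n) f) = mollify (d n) (grad f)" for n
    using grad_eqI[OF GDERIV_mollify[OF d(1) f(1)]] by blast
  have "mollify (d n) f \<in> test_functions \<Omega>" for n
  proof -
    have "closure {x. mollify (d n) f x \<noteq> 0} \<subseteq> L"
      using outside[OF f_cont K(3)] L by (intro closure_minimal compact_imp_closed) auto
    moreover from this have "compact (closure {x. mollify (d n) f x \<noteq> 0})"
      using L by (meson bounded_subset closed_closure compact_eq_bounded_closed)
    ultimately show ?thesis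
      using Ck \<open>L \<subseteq> \<Omega>\<close> by (auto simp: test_functions_def)
  qed
  moreover have "\<forall>x. 0 \<le> mollify (d n) f x" for n
    using mollify_nonneg[OF d(1)] f(2) by blast
  \<comment> \<open>The factor \<open>1\<close> only casts the scalar integral into the inner
    product form of the limit lemma.\<close>
  ultimately have ineq: "c * (LINT x|lborel. 1 \<bullet> mollify (d n) f x) \<le>
      (LINT x|lborel. F x \<bullet> mollify (d n) (grad f) x)" for n
    using weak[of "mollify (d n) f"] by (simp add: grad)
  have "(\<lambda>n. c * (LINT x|lborel. 1 \<bullet> mollify (d n) f x)) \<longlonglongrightarrow>
      c * (LINT x|lborel. 1 \<bullet> f x)"
    using outside[OF f_cont K(3)] Ck[of 0]
    by (intro tendsto_mult_left LINT_mollify_tendsto[OF f_cont K(1,3) continuous_on_const d(1) d0 L])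
      auto
  moreover have "(\<lambda>n. LINT x|lborel. F x \<bullet> mollify (d n) (grad f) x) \<longlonglongrightarrow>
      (LINT x|lborel. F x \<bullet> grad f x)"
    using outside[OF grad_cont grad0] C1_continuous_grad[OF C1_if_C_k[OF Ck]]
    by (intro LINT_mollify_tendsto[OF grad_cont K(1) grad0 F d(1) d0 L]) (auto simp: grad)
  ultimately have "c * (LINT x|lborel. 1 \<bullet> f x) \<le> (LINT x|lborel. F x \<bullet> grad f x)"
    by (rule LIMSEQ_le) (use ineq in blast)
  then show ?thesis by simp
qed

section \<open>Cut-off of the weak inequalities\<close>

text \<open>The field inside the divergence of the p-Laplacian. It is zero at \<open>a = 0\<close>
  for every \<open>p\<close>, since the vector factor vanishes.\<close>

definition flux :: "real \<Rightarrow> 'a::euclidean_space \<Rightarrow> 'a" where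
  "flux p a = norm a powr (p - 2) *\<^sub>R a"

lemma norm_flux: "1 < p \<Longrightarrow> norm (flux p a) = norm a powr (p - 1)"
  by (cases "a = 0") (auto simp: flux_def powr_mult_base[symmetric] powr_diff field_simps power2_eq_square)

text \<open>Only the origin is critical, since \<open>norm a powr (p - 2)\<close> is unbounded near
  it when \<open>p < 2\<close>; the norm of the product is the positive power
  \<open>p - 1\<close>.\<close>

lemma continuous_on_flux:
  assumes "1 < p"
  shows "continuous_on UNIV (flux p :: 'a::euclidean_space \<Rightarrow> 'a)"
proof -
  have "isCont (flux p) a" for a :: 'a
  proof (cases "a = 0")
    case False
    then show ?thesis unfolding flux_def by (intro continuous_intros) auto
  next
    case True
    have "((\<lambda>x::'a. norm x powr (p - 1)) \<longlongrightarrow> norm (0::'a) powr (p - 1)) (at 0)"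
      using assms by (intro tendsto_intros tendsto_powr') auto
    then have "((\<lambda>x::'a. norm (flux p x)) \<longlongrightarrow> 0) (at 0)"
      using assms by (simp add: norm_flux)
    then have "(flux p \<longlongrightarrow> 0) (at (0::'a))"
      by (rule tendsto_norm_zero_cancel)
    moreover have "flux p a = 0" using True by (simp add: flux_def)
    ultimately show ?thesis using True by (simp add: isCont_def)
  qed
  then show ?thesis by (simp add: continuous_at_imp_continuous_on)
qed

lemma set_LINT_lebesgue_eq:
  fixes g :: "'a::euclidean_space \<Rightarrow> real"
  assumes "g \<in> borel_measurable borel" and "\<And>x. x \<notin> S \<Longrightarrow> g x = 0"
  shows "(LINT x:S|lebesgue. g x) = (LINT x|lborel. g x)"
proof -
  have "(\<lambda>x. indicator S x *\<^sub>R g x) = g"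
    by (rule ext) (use assms(2) in \<open>force simp: indicator_def\<close>)
  then show ?thesis
    unfolding set_lebesgue_integral_def using assms(1) by (simp add: integral_completion)
qed

text \<open>A test function and its gradient vanish off \<open>\<Omega>\<close>, so the integrals
  over \<open>\<Omega>\<close> are Borel integrals over the whole space, to which the mollification
  result applies.\<close>

lemma weak_minus_p_Laplacian_ge_C1:
  fixes u f :: "'a::euclidean_space \<Rightarrow> real"
  assumes weak: "weak_minus_p_Laplacian_ge p u (\<lambda>_. c) \<Omega>" and "1 < p" and u: "C1 u" and "open \<Omega>"
    and "C1 f" and "\<And>x. 0 \<le> f x" and "compact K" and "K \<subseteq> \<Omega>" and "\<And>x. x \<notin> K \<Longrightarrow> f x = 0"
  shows "c * (LINT x|lborel. f x) \<le> (LINT x|lborel. flux p (grad u x) \<bullet> grad f x)"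
proof (rule weak_inequality_C1[OF _ _ \<open>open \<Omega>\<close>, where K=K])
  have F: "continuous_on UNIV (\<lambda>x. flux p (grad u x))"
    by (rule continuous_on_compose2[OF continuous_on_flux[OF \<open>1 < p\<close>] C1_continuous_grad[OF u]]) simp
  then show "continuous_on UNIV (\<lambda>x. flux p (grad u x))" .
  fix \<phi> assume \<phi>: "\<phi> \<in> test_functions \<Omega>" and nonneg: "\<forall>x. 0 \<le> \<phi> x"
  define L where "L = closure {x. \<phi> x \<noteq> 0}"
  have L: "closed L" "L \<subseteq> \<Omega>" and zero: "\<And>x. x \<notin> L \<Longrightarrow> \<phi> x = 0"
    using \<phi> closure_subset[of "{x. \<phi> x \<noteq> 0}"] by (auto simp: test_functions_def L_def)
  have "C1 \<phi>" using \<phi> by (intro C1_if_C_k) (auto simp: test_functions_def)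
  have grad0: "grad \<phi> x = 0" if "x \<notin> \<Omega>" for x
    using L zero that by (intro grad_zero_outside[of L]) auto
  have "(LINT x:\<Omega>|lebesgue. c * \<phi> x) = (LINT x|lborel. c * \<phi> x)"
    using L zero C1_continuous[OF \<open>C1 \<phi>\<close>, of UNIV]
    by (intro set_LINT_lebesgue_eq) (auto intro!: borel_measurable_continuous_onI continuous_on_mult_left)
  moreover have "(LINT x:\<Omega>|lebesgue. flux p (grad u x) \<bullet> grad \<phi> x) =
      (LINT x|lborel. flux p (grad u x) \<bullet> grad \<phi> x)"
    using grad0 C1_continuous_grad[OF \<open>C1 \<phi>\<close>, of UNIV] F
    by (intro set_LINT_lebesgue_eq) (auto intro!: borel_measurable_continuous_onI continuous_on_inner)
  ultimately show "c * (LINT x|lborel. \<phi> x) \<le> (LINT x|lborel. flux p (grad u x) \<bullet> grad \<phi> x)"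
    using weak \<phi> nonneg unfolding weak_minus_p_Laplacian_ge_def flux_def by fastforce
qed (use assms in auto)

section \<open>Product and chain rules, positive part and cut-off profile\<close>

lemma C1_mult: "C1 f \<Longrightarrow> C1 g \<Longrightarrow> C1 (\<lambda>x. f x * g x)"
  by (rule C1I(1)[OF GDERIV_mult[OF C1_GDERIV C1_GDERIV]])
    (simp_all add: continuous_on_add continuous_on_scaleR C1_continuous C1_continuous_grad)

lemma GDERIV_compose:
  assumes "C1 g" and "\<And>t. DERIV h t :> h' t"
  shows "GDERIV (\<lambda>x. h (g x)) x :> h' (g x) *\<^sub>R grad g x"
  using GDERIV_DERIV_compose[OF C1_GDERIV[OF assms(1)] assms(2)] .

lemma C1_compose:
  assumes "C1 g" and "\<And>t. DERIV h t :> h' t" and h': "continuous_on UNIV h'"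
  shows "C1 (\<lambda>x. h (g x))"
proof (rule C1I(1)[OF GDERIV_compose[OF assms(1,2)]])
  show "continuous_on UNIV (\<lambda>x. h' (g x) *\<^sub>R grad g x)"
    by (intro continuous_on_scaleR continuous_on_compose2[OF h'] C1_continuous C1_continuous_grad
        assms(1)) simp
qed

lemma DERIV_pos_part_square: "DERIV (\<lambda>t. (max 0 t)\<^sup>2) t :> 2 * max 0 (t::real)"
proof (cases t "0::real" rule: linorder_cases)
  case less
  have "DERIV (\<lambda>_. 0) t :> (0::real)" by simp
  then have "DERIV (\<lambda>t. (max 0 t)\<^sup>2) t :> 0"
    by (rule has_field_derivative_transform_within_open[where S="{..<0}"]) (use less in auto)
  with less show ?thesis by simp
next
  case greater
  have "DERIV (\<lambda>t. t\<^sup>2) t :> 2 * t" by (auto intro!: derivative_eq_intros)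
  then have "DERIV (\<lambda>t. (max 0 t)\<^sup>2) t :> 2 * t"
    by (rule has_field_derivative_transform_within_open[where S="{0<..}"]) (use greater in auto)
  with greater show ?thesis by simp
next
  case equal
  have "((\<lambda>y::real. max 0 y) \<longlongrightarrow> max 0 0) (at 0)"
    by (intro tendsto_intros)
  then have "((\<lambda>y::real. max 0 y) \<longlongrightarrow> 0) (at 0)" by simp
  \<comment> \<open>On both sides of zero the difference quotient of the squared positive part is
    \<open>max 0 y\<close>.\<close>
  then have "((\<lambda>y::real. ((max 0 y)\<^sup>2 - (max 0 0)\<^sup>2) / (y - 0)) \<longlongrightarrow> 0) (at 0)"
    by (rule Lim_transform_eventually)
      (auto simp: eventually_at max_def power2_eq_square intro!: exI[of _ 1])
  with equal show ?thesis by (simp add: has_field_derivative_iff)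
qed

text \<open>A \<open>C1\<close> profile, equal to 1 on the nonpositive axis and tending to 0 at
  infinity. Its complement \<open>1 - step\<close> is the part to be supported in the ball, and it
  tends to 1 as its argument grows.\<close>

definition step :: "real \<Rightarrow> real" where
  "step t = 1 / (1 + (max 0 t)\<^sup>2)"

lemma step_bounds: "0 \<le> step t" "step t \<le> 1"
  by (simp_all add: step_def divide_le_eq_1 add_pos_nonneg)

lemma step_nonpos: "t \<le> 0 \<Longrightarrow> step t = 1"
  by (simp add: step_def)

lemma DERIV_step: "DERIV step t :> - (2 * max 0 t) / (1 + (max 0 t)\<^sup>2)\<^sup>2"
proof -
  have "1 + (max 0 t)\<^sup>2 \<noteq> 0" using zero_le_power2[of "max 0 t"] by linarith
  moreover have "DERIV (\<lambda>t. 1 + (max 0 t)\<^sup>2) t :> 0 + 2 * max 0 t"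
    by (intro DERIV_add DERIV_const DERIV_pos_part_square)
  ultimately have "DERIV (\<lambda>t. inverse (1 + (max 0 t)\<^sup>2)) t :>
      - (inverse (1 + (max 0 t)\<^sup>2) * (0 + 2 * max 0 t) * inverse (1 + (max 0 t)\<^sup>2))"
    by (intro DERIV_inverse')
  then show ?thesis
    by (simp add: step_def[abs_def] inverse_eq_divide power2_eq_square)
qed

lemma continuous_DERIV_step: "continuous_on UNIV (\<lambda>t. - (2 * max 0 t) / (1 + (max 0 t)\<^sup>2)\<^sup>2 :: real)"
proof -
  have "(1 + (max 0 t)\<^sup>2)\<^sup>2 \<noteq> 0" for t :: real
    using zero_le_power2[of "max 0 t"] by (simp add: add_nonneg_eq_0_iff)
  then show ?thesis by (intro continuous_intros) simp
qed

lemma step_tendsto_0: "(step \<longlongrightarrow> 0) at_top"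
  unfolding step_def[abs_def] by real_asymp

lemma grad_add: "C1 f \<Longrightarrow> C1 g \<Longrightarrow> grad (\<lambda>x. f x + g x) x = grad f x + grad g x"
  by (intro grad_eqI GDERIV_add C1_GDERIV)

text \<open>The test function is split by a cut-off of the ball.\<close>

lemma weak_inequality_indicator:
  fixes F :: "'a::euclidean_space \<Rightarrow> 'a" and f :: "'a \<Rightarrow> real"
  assumes F: "continuous_on UNIV F"
    and ball: "\<And>g K. C1 g \<Longrightarrow> (\<And>x. 0 \<le> g x) \<Longrightarrow> compact K \<Longrightarrow> K \<subseteq> ball 0 r \<Longrightarrow>
      (\<And>x. x \<notin> K \<Longrightarrow> g x = 0) \<Longrightarrow> c * (LINT x|lborel. g x) \<le> (LINT x|lborel. F x \<bullet> grad g x)"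
    and global: "\<And>g K. C1 g \<Longrightarrow> (\<And>x. 0 \<le> g x) \<Longrightarrow> compact K \<Longrightarrow>
      (\<And>x. x \<notin> K \<Longrightarrow> g x = 0) \<Longrightarrow> 0 \<le> (LINT x|lborel. F x \<bullet> grad g x)"
    and f: "C1 f" "\<And>x. 0 \<le> f x" and K: "compact K" "\<And>x. x \<notin> K \<Longrightarrow> f x = 0" and "0 < r"
  shows "c * (LINT x|lborel. indicator (ball 0 r) x * f x) \<le> (LINT x|lborel. F x \<bullet> grad f x)"
proof -
  \<comment> \<open>\<open>t n x\<close> is positive only for
    \<open>x \<bullet> x < r^2 - 1 / real (Suc n)\<close>: the shift by 1 keeps the inner part off
    the sphere, and the factor \<open>Suc n\<close> drives \<open>t n x\<close> to infinity at each
    point of the ball.\<close>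
  define t where "t n x = real (Suc n) * (r\<^sup>2 - x \<bullet> x) - 1" for n and x :: 'a
  have C1t: "C1 (t n)" for n
  proof (rule C1I(1))
    show "GDERIV (t n) x :> - (2 * real (Suc n)) *\<^sub>R x" for x
      unfolding gderiv_def t_def
      by (auto intro!: derivative_eq_intros simp: inner_commute algebra_simps)
  qed (intro continuous_intros)
  have C1step: "C1 (\<lambda>x. step (t n x))" for n
    by (rule C1_compose[OF C1t DERIV_step continuous_DERIV_step])
  have "C1 (\<lambda>x. 1 - step (t n x))" for n
    by (rule C1_compose[OF C1step, where h="\<lambda>s. 1 - s" and h'="\<lambda>_. - 1"])
      (auto intro!: derivative_eq_intros)
  then have C1in: "C1 (\<lambda>x. f x * (1 - step (t n x)))" for n
    by (rule C1_mult[OF f(1)])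
  have C1out: "C1 (\<lambda>x. f x * step (t n x))" for n
    by (rule C1_mult[OF f(1) C1step])
  have ineq: "c * (LINT x|lborel. f x * (1 - step (t n x))) \<le> (LINT x|lborel. F x \<bullet> grad f x)" for n
  proof -
    let ?g = "\<lambda>x. f x * (1 - step (t n x))" and ?h = "\<lambda>x. f x * step (t n x)"
    define L where "L = cball 0 r \<inter> {x. 0 \<le> t n x}"
    have "compact L"
      unfolding L_def
      by (intro compact_Int_closed compact_cball closed_Collect_le C1_continuous[OF C1t] continuous_on_const)
    moreover have "L \<subseteq> ball 0 r"
    proof
      fix x assume "x \<in> L"
      then have "0 \<le> t n x" by (simp add: L_def)
      then have "0 < real (Suc n) * (r\<^sup>2 - x \<bullet> x)" by (simp add: t_def)
      then have "(norm x)\<^sup>2 < r\<^sup>2"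
        by (simp add: zero_less_mult_iff power2_norm_eq_inner)
      then show "x \<in> ball 0 r"
        using \<open>0 < r\<close> power2_less_imp_less[of "norm x" r] by simp
    qed
    moreover have "?g x = 0" if "x \<notin> L" for x
    proof -
      have "t n x \<le> 0"
      proof (cases "norm x \<le> r")
        case True
        with that show ?thesis by (simp add: L_def)
      next
        case False
        then have "r\<^sup>2 \<le> x \<bullet> x"
          using \<open>0 < r\<close> power_mono[of r "norm x" 2] by (simp add: power2_norm_eq_inner)
        then have "real (Suc n) * (r\<^sup>2 - x \<bullet> x) \<le> 0"
          by (intro mult_nonneg_nonpos) auto
        then show ?thesis by (simp add: t_def)
      qed
      then show ?thesis by (simp add: step_nonpos)
    qed
    ultimately have "c * (LINT x|lborel. ?g x) \<le> (LINT x|lborel. F x \<bullet> grad ?g x)"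
      using f(2) step_bounds by (intro ball[OF C1in]) auto
    moreover have "0 \<le> (LINT x|lborel. F x \<bullet> grad ?h x)"
      using f(2) step_bounds K by (intro global[OF C1out[of n], where K=K]) auto
    \<comment> \<open>\<open>F\<close> is the same in both inequalities and the gradients of the two
      parts add up to \<open>grad f\<close>, so the inequalities add.\<close>
    moreover have "(LINT x|lborel. F x \<bullet> grad ?g x) + (LINT x|lborel. F x \<bullet> grad ?h x) =
      (LINT x|lborel. F x \<bullet> grad f x)"
    proof -
      have int: "integrable lborel (\<lambda>x. F x \<bullet> grad g x)" if "C1 g" "\<And>x. x \<notin> K \<Longrightarrow> g x = 0" for g
        using that K(1) grad_zero_outside[of K g]
        by (intro integrable_continuous_compact_support[of _ K] continuous_on_inner F
            C1_continuous_grad) (simp_all add: compact_imp_closed)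
      have "grad f x = grad ?g x + grad ?h x" for x
        using grad_add[OF C1in C1out, of n n x] by (simp add: algebra_simps)
      then have "(LINT x|lborel. F x \<bullet> grad f x) = (LINT x|lborel. F x \<bullet> grad ?g x + F x \<bullet> grad ?h x)"
        by (simp add: inner_add_right)
      also have "\<dots> = (LINT x|lborel. F x \<bullet> grad ?g x) + (LINT x|lborel. F x \<bullet> grad ?h x)"
        using K(2) by (intro Bochner_Integration.integral_add int C1in C1out) simp_all
      finally show ?thesis by simp
    qed
    ultimately show ?thesis by linarith
  qed
  have "(\<lambda>n. LINT x|lborel. f x * (1 - step (t n x))) \<longlonglongrightarrow> (LINT x|lborel. indicator (ball 0 r) x * f x)"
  proof (rule integral_dominated_convergence[where w=f])
    have f_meas: "f \<in> borel_measurable borel"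
      by (intro borel_measurable_continuous_onI C1_continuous f)
    then show "(\<lambda>x. indicator (ball 0 r) x * f x) \<in> borel_measurable lborel"
      by (simp add: borel_measurable_times borel_measurable_indicator)
    show "(\<lambda>x. f x * (1 - step (t n x))) \<in> borel_measurable lborel" for n
      using C1_continuous[OF C1in, of UNIV] by (simp add: borel_measurable_continuous_onI)
    show "integrable lborel f"
      using K by (intro integrable_continuous_compact_support[of _ K] C1_continuous f)
    show "AE x in lborel. norm (f x * (1 - step (t n x))) \<le> f x" for n
      using f(2) step_bounds by (intro AE_I2) (auto simp: abs_mult intro!: mult_left_le)
    show "AE x in lborel. (\<lambda>n. f x * (1 - step (t n x))) \<longlonglongrightarrow> indicator (ball 0 r) x * f x"
    proof (intro AE_I2)
      fix x
      have "(\<lambda>n. step (t n x)) \<longlonglongrightarrow> 1 - indicator (ball 0 r) x"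
      proof (cases "norm x < r")
        case True
        then have pos: "0 < r\<^sup>2 - x \<bullet> x"
          using power_strict_mono[of "norm x" r 2] by (simp add: power2_norm_eq_inner)
        have "filterlim (\<lambda>n. t n x) at_top sequentially"
          unfolding t_def using pos by real_asymp
        with True show ?thesis
          using filterlim_compose[OF step_tendsto_0] by (simp add: indicator_def)
      next
        case False
        then have "r\<^sup>2 \<le> x \<bullet> x"
          using \<open>0 < r\<close> power_mono[of r "norm x" 2] by (simp add: power2_norm_eq_inner)
        then have "real (Suc n) * (r\<^sup>2 - x \<bullet> x) \<le> 0" for n
          by (intro mult_nonneg_nonpos) auto
        then have "t n x \<le> 0" for n
          unfolding t_def by (smt (verit))
        with False show ?thesis by (simp add: step_nonpos indicator_def)
      qed
      from tendsto_mult[OF tendsto_const[of "f x"] tendsto_diff[OF tendsto_const[of 1] this]]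
      show "(\<lambda>n. f x * (1 - step (t n x))) \<longlonglongrightarrow> indicator (ball 0 r) x * f x"
        by (simp add: mult.commute)
    qed
  qed
  from tendsto_mult_left[OF this, of c] show ?thesis
    by (rule LIMSEQ_le_const2) (use ineq in blast)
qed

section \<open>Divergence of the radial field\<close>

text \<open>On the sphere itself the right difference quotients of the weight used below tend to
  minus the dimension, whereas the indicator of the open ball gives 0; the sphere has to be
  discarded as a null set.\<close>

lemma AE_norm_neq: "AE x::'a::euclidean_space in lborel. norm x \<noteq> r"
proof -
  have "sphere (0::'a) r \<in> null_sets lborel"
    using negligible_sphere[of "0::'a" r]
    by (simp add: negligible_iff_null_sets null_sets_completion_iff)
  from AE_not_in[OF this] show ?thesis by simp
qed

text \<open>Dilations are used only for factors \<open>t \<ge> 1\<close>, and dominated convergence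
  asks for a sequence; hence a one-sided derivative along
  \<open>1 + 1 / real (Suc n)\<close>.\<close>

lemma DERIV_right_sequence:
  assumes "(g has_real_derivative D) (at 1 within {1..})"
  shows "(\<lambda>n. real (Suc n) * (g (1 + 1 / real (Suc n)) - g 1)) \<longlonglongrightarrow> D"
proof -
  have lim: "((\<lambda>y. (g y - g 1) / (y - 1)) \<longlongrightarrow> D) (at 1 within {1..})"
    using assms by (simp add: has_field_derivative_iff)
  have "filterlim (\<lambda>n. 1 + 1 / real (Suc n)) (at 1 within {1..}) sequentially"
    unfolding filterlim_at
  proof
    show "eventually (\<lambda>n. 1 + 1 / real (Suc n) \<in> {1..} \<and> 1 + 1 / real (Suc n) \<noteq> 1) sequentially"
      by (intro always_eventually allI) (simp add: field_simps)
    show "(\<lambda>n. 1 + 1 / real (Suc n)) \<longlonglongrightarrow> 1" by real_asymp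
  qed
  from filterlim_compose[OF lim this] show ?thesis
    by (simp add: mult.commute)
qed

text \<open>With \<open>a\<close> the base at 1 and \<open>b\<close> the base at \<open>t\<close>,
  one has \<open>a / t \<le> b \<le> a\<close>, and Bernoulli's inequality bounds the loss. The
  bound is uniform in \<open>s\<close>, which makes it a majorant for the difference
  quotients.\<close>

lemma radial_weight_bound:
  fixes r s t :: real
  assumes "0 < r" and "1 \<le> t"
  shows "\<bar>(r / max (t * r) s) ^ N - (r / max r s) ^ N\<bar> \<le> real N * (t - 1)"
proof -
  define a where "a = r / max r s"
  define b where "b = r / max (t * r) s"
  have a: "0 \<le> a" "a \<le> 1" using assms(1) by (auto simp: a_def)
  have "r \<le> t * r" using assms by simp
  then have le: "max r s \<le> max (t * r) s" by (intro max.mono) simp_all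
  moreover have pos: "0 < max r s" using assms(1) by simp
  ultimately have "b \<le> a" unfolding a_def b_def
    using assms(1) by (intro divide_left_mono mult_pos_pos) linarith+
  have "max (t * r) s \<le> t * max r s"
  proof (rule max.boundedI)
    have "1 * max r s \<le> t * max r s" using assms(2) pos by (intro mult_right_mono) auto
    then show "s \<le> t * max r s" by simp
    show "t * r \<le> t * max r s" using assms(2) by (intro mult_left_mono) auto
  qed
  then have "r / (t * max r s) \<le> b" unfolding b_def
    using assms pos le by (intro divide_left_mono mult_pos_pos) auto
  then have ab: "a * (1 / t) \<le> b" by (simp add: a_def mult.commute)
  have "0 \<le> b" using ab a assms order_trans[of 0 "a * (1 / t)" b] by simp
  have "a ^ N - b ^ N \<le> a ^ N - (a * (1 / t)) ^ N"
    using ab a assms power_mono[of "a * (1 / t)" b N] by simp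
  also have "\<dots> = a ^ N * (1 - (1 / t) ^ N)"
    by (simp only: power_mult_distrib right_diff_distrib mult_1_right)
  also have "\<dots> \<le> 1 * (1 - (1 / t) ^ N)"
    using a assms by (intro mult_right_mono power_le_one) (auto intro: power_le_one)
  also have "\<dots> \<le> real N * (1 - 1 / t)"
    using Bernoulli_inequality[of "1 / t - 1" N] assms by (simp add: algebra_simps)
  also have "\<dots> \<le> real N * (t - 1)"
  proof (rule mult_left_mono)
    have "2 * t \<le> t * t + 1" using zero_le_power2[of "t - 1"] by (simp add: power2_eq_square algebra_simps)
    with assms show "1 - 1 / t \<le> t - 1" by (simp add: field_simps)
  qed simp
  finally have "a ^ N - b ^ N \<le> real N * (t - 1)" .
  moreover have "b ^ N \<le> a ^ N" using \<open>b \<le> a\<close> \<open>0 \<le> b\<close> by (rule power_mono)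
  ultimately show ?thesis by (simp add: a_def b_def)
qed

text \<open>Both sides are the derivative at \<open>t = 1\<close> of \<open>\<integral> (r / max r |x|)\<^sup>N f(tx) dx\<close>, computed before and after
  the substitution \<open>y = tx\<close>.\<close>

lemma divergence_radial_field:
  fixes f :: "'a::euclidean_space \<Rightarrow> real"
  assumes f: "C1 f" and K: "compact K" "\<And>x. x \<notin> K \<Longrightarrow> f x = 0" and r: "0 < r"
  shows "(LINT x|lborel. ((r / max r (norm x)) ^ DIM('a) *\<^sub>R x) \<bullet> grad f x) =
    - real DIM('a) * (LINT x|lborel. indicator (ball 0 r) x * f x)"
proof -
  define N where "N = DIM('a)"
  \<comment> \<open>\<open>w 1\<close> is the coefficient of the field. For general \<open>t\<close>
    the threshold \<open>r\<close> becomes \<open>t * r\<close>, which is what the substitution does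
    to it.\<close>
  define w where "w t x = (r / max (t * r) (norm x)) ^ N" for t and x :: 'a
  define J where "J t = (LINT x|lborel. w 1 x * f (t *\<^sub>R x))" for t
  define T where "T n = 1 + 1 / real (Suc n)" for n
  have T: "1 < T n" for n by (simp add: T_def)
  have w_cont: "continuous_on S (w t)" if "1 \<le> t" for t S
  proof -
    have "0 < t * r" using that r by simp
    then have "max (t * r) (norm x) \<noteq> 0" for x :: 'a by (smt (verit) max.cobounded1)
    then show ?thesis unfolding w_def by (intro continuous_intros) auto
  qed
  note f_cont = C1_continuous[OF f, of UNIV] and grad_cont = C1_continuous_grad[OF f, of UNIV]
  have fs_cont: "continuous_on S (\<lambda>x. f (t *\<^sub>R x))" for t S
    by (rule continuous_on_compose2[OF f_cont]) (intro continuous_intros, simp)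
  obtain R where R: "\<And>x. x \<in> K \<Longrightarrow> norm x \<le> R"
    using compact_imp_bounded[OF K(1)] by (auto simp: bounded_iff)
  obtain b :: 'a where b: "cball 0 R \<subseteq> cbox (- b) b"
    using bounded_subset_cbox_symmetric[OF bounded_cball] by blast
  \<comment> \<open>For \<open>t \<ge> 1\<close> the support of the dilated function only shrinks,
    so one box serves all \<open>t\<close> in the Leibniz rule.\<close>
  have out: "t *\<^sub>R x \<notin> K" if "1 \<le> t" "x \<notin> cbox (- b) b" for t x
  proof
    assume "t *\<^sub>R x \<in> K"
    then have "t * norm x \<le> R" using R[of "t *\<^sub>R x"] that by simp
    moreover have "norm x \<le> t * norm x"
      using that mult_right_mono[of 1 t "norm x"] by simp
    ultimately have "x \<in> cball 0 R" by simp
    with b that show False by blast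
  qed
  \<comment> \<open>The Jacobian \<open>(1 / t) ^ N\<close> is absorbed into the weight because the
    exponent of the weight is the dimension.\<close>
  have J_scaled: "J t = (LINT x|lborel. w t x * f x)" if "1 \<le> t" for t
  proof -
    have "J t = \<bar>1 / t\<bar> ^ N *\<^sub>R (LINT x|lborel. w 1 (0 + (1 / t) *\<^sub>R x) * f (t *\<^sub>R (0 + (1 / t) *\<^sub>R x)))"
      unfolding J_def N_def using that
      by (intro LINT_lborel_affine borel_measurable_continuous_onI continuous_on_mult w_cont fs_cont) auto
    also have "\<dots> = (LINT x|lborel. (1 / t) ^ N * (w 1 ((1 / t) *\<^sub>R x) * f x))"
      using that by simp
    also have "\<dots> = (LINT x|lborel. w t x * f x)"
    proof (rule Bochner_Integration.integral_cong)
      fix x :: 'a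
      have eq: "t * max r (norm x / t) = max (t * r) (norm x)"
        using that by (simp add: max_def field_simps)
      have "(1 / t) ^ N * w 1 ((1 / t) *\<^sub>R x) = (1 / t) ^ N * (r / max r (norm x / t)) ^ N"
        using that by (simp add: w_def)
      also have "\<dots> = (r / (t * max r (norm x / t))) ^ N"
        by (simp only: power_mult_distrib[symmetric] times_divide_times_eq mult_1)
      also have "\<dots> = w t x" by (simp only: eq w_def)
      finally have "(1 / t) ^ N * w 1 ((1 / t) *\<^sub>R x) = w t x" .
      then show "(1 / t) ^ N * (w 1 ((1 / t) *\<^sub>R x) * f x) = w t x * f x"
        by (simp flip: mult.assoc)
    qed simp
    finally show ?thesis .
  qed
  have J_box: "J t = integral (cbox (- b) b) (\<lambda>x. w 1 x * f (t *\<^sub>R x))" if "1 \<le> t" for t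
    unfolding J_def using out[OF that] K(2)
    by (intro LINT_lborel_eq_integral_cbox continuous_on_mult w_cont fs_cont) auto
  have "((\<lambda>t. integral (cbox (- b) b) (\<lambda>x. w 1 x * f (t *\<^sub>R x))) has_real_derivative
      integral (cbox (- b) b) (\<lambda>x. w 1 x * (x \<bullet> grad f (1 *\<^sub>R x)))) (at 1 within {1..})"
  proof (rule leibniz_rule_field_derivative[where U="{1..}"
        and fx="\<lambda>t x. w 1 x * (x \<bullet> grad f (t *\<^sub>R x))"])
    fix t :: real and x :: 'a
    have "(f has_derivative (\<lambda>v. v \<bullet> grad f (t *\<^sub>R x))) (at (t *\<^sub>R x))"
      using C1_GDERIV[OF f] by (simp add: gderiv_def)
    then have "((\<lambda>t. f (t *\<^sub>R x)) has_derivative (\<lambda>s. (s *\<^sub>R x) \<bullet> grad f (t *\<^sub>R x))) (at t)"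
      by (rule has_derivative_compose[rotated]) (auto intro!: derivative_eq_intros)
    then have "DERIV (\<lambda>t. f (t *\<^sub>R x)) t :> x \<bullet> grad f (t *\<^sub>R x)"
      by (simp add: has_field_derivative_def mult_commute_abs)
    then show "((\<lambda>t. w 1 x * f (t *\<^sub>R x)) has_real_derivative w 1 x * (x \<bullet> grad f (t *\<^sub>R x)))
        (at t within {1..})"
      by (intro has_field_derivative_at_within[OF DERIV_cmult])
  next
    show "(\<lambda>x. w 1 x * f (t *\<^sub>R x)) integrable_on cbox (- b) b" for t
      by (intro integrable_continuous continuous_on_mult w_cont fs_cont) simp
    show "continuous_on ({1..} \<times> cbox (- b) b) (\<lambda>(t, x). w 1 x * (x \<bullet> grad f (t *\<^sub>R x)))"
      unfolding split_beta
      by (intro continuous_intros continuous_on_compose2[OF w_cont[of 1 UNIV]]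
          continuous_on_compose2[OF grad_cont]) auto
  qed auto
  then have "(J has_real_derivative integral (cbox (- b) b) (\<lambda>x. w 1 x * (x \<bullet> grad f x)))
      (at 1 within {1..})"
    unfolding scaleR_one
    by (rule has_field_derivative_transform_within[where d=1]) (simp_all add: J_box)
  also have "integral (cbox (- b) b) (\<lambda>x. w 1 x * (x \<bullet> grad f x)) =
      (LINT x|lborel. w 1 x * (x \<bullet> grad f x))"
  proof (rule LINT_lborel_eq_integral_cbox[symmetric])
    show "continuous_on UNIV (\<lambda>x. w 1 x * (x \<bullet> grad f x))"
      by (intro continuous_intros w_cont grad_cont) simp
    fix x assume "x \<notin> cbox (- b) b"
    with out[of 1 x] show "w 1 x * (x \<bullet> grad f x) = 0"
      using K grad_zero_outside[of K f x] by (simp add: compact_imp_closed)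
  qed
  finally have lim1: "(\<lambda>n. real (Suc n) * (J (T n) - J 1)) \<longlonglongrightarrow>
      (LINT x|lborel. w 1 x * (x \<bullet> grad f x))"
    unfolding T_def by (rule DERIV_right_sequence)
  have int: "integrable lborel (\<lambda>x. w t x * f x)" if "1 \<le> t" for t
    using K that
    by (intro integrable_continuous_compact_support[of _ K] continuous_on_mult w_cont f_cont) auto
  have "(\<lambda>n. LINT x|lborel. real (Suc n) * (w (T n) x - w 1 x) * f x) \<longlonglongrightarrow>
      (LINT x|lborel. - real N * indicator (ball 0 r) x * f x)"
  proof (rule integral_dominated_convergence[where w="\<lambda>x. real N * \<bar>f x\<bar>"])
    have f_meas: "f \<in> borel_measurable borel"
      by (rule borel_measurable_continuous_onI[OF f_cont])
    then show "(\<lambda>x. - real N * indicator (ball 0 r) x * f x) \<in> borel_measurable lborel"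
      by (simp add: borel_measurable_times borel_measurable_indicator)
    show "(\<lambda>x. real (Suc n) * (w (T n) x - w 1 x) * f x) \<in> borel_measurable lborel" for n
      using w_cont[of "T n" UNIV] w_cont[of 1 UNIV] T[of n] f_cont
      by (simp add: borel_measurable_continuous_onI continuous_on_mult continuous_on_diff)
    show "integrable lborel (\<lambda>x. real N * \<bar>f x\<bar>)"
      using K by (intro integrable_mult_right integrable_abs
        integrable_continuous_compact_support[of _ K] f_cont)
    show "AE x in lborel. norm (real (Suc n) * (w (T n) x - w 1 x) * f x) \<le> real N * \<bar>f x\<bar>" for n
    proof (intro AE_I2)
      fix x
      have "real (Suc n) * \<bar>w (T n) x - w 1 x\<bar> \<le> real (Suc n) * (real N * (T n - 1))"
        using radial_weight_bound[OF r, of "T n" "norm x" N] T[of n]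
        by (intro mult_left_mono) (simp_all add: w_def)
      also have "\<dots> = real N" by (simp add: T_def)
      finally show "norm (real (Suc n) * (w (T n) x - w 1 x) * f x) \<le> real N * \<bar>f x\<bar>"
        by (simp add: abs_mult mult_right_mono del: of_nat_Suc)
    qed
    show "AE x in lborel. (\<lambda>n. real (Suc n) * (w (T n) x - w 1 x) * f x) \<longlonglongrightarrow>
        - real N * indicator (ball 0 r) x * f x"
      using AE_norm_neq[of r]
    proof eventually_elim
      fix x :: 'a assume neq: "norm x \<noteq> r"
      have "(\<lambda>n. real (Suc n) * (w (T n) x - w 1 x)) \<longlonglongrightarrow> - real N * indicator (ball 0 r) x"
      \<comment> \<open>In the ball \<open>w t x\<close> is \<open>t\<close> to the power
        \<open>-N\<close>, with derivative \<open>-N\<close> at 1; beyond the sphere it is constant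
        for \<open>t\<close> close to 1.\<close>
      proof (cases "norm x < r")
        case True
        have "w t x = inverse t ^ N" if "1 \<le> t" for t
        proof -
          have "r \<le> t * r" using that r by simp
          with True have "max (t * r) (norm x) = t * r" by simp
          with r show ?thesis by (simp add: w_def inverse_eq_divide)
        qed
        moreover have "DERIV (\<lambda>t. inverse t ^ N) 1 :> - real N"
          by (auto intro!: derivative_eq_intros)
        then have "(\<lambda>n. real (Suc n) * (inverse (T n) ^ N - inverse 1 ^ N)) \<longlonglongrightarrow> - real N"
          unfolding T_def by (rule DERIV_right_sequence[OF has_field_derivative_at_within])
        ultimately show ?thesis
          using True T by (simp add: indicator_def less_imp_le)
      next
        case False
        with neq have less: "r < norm x" by simp
        have "(\<lambda>n. T n * r) \<longlonglongrightarrow> 1 * r"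
          unfolding T_def by (intro tendsto_intros) real_asymp
        then have "eventually (\<lambda>n. T n * r < norm x) sequentially"
          using less by (simp add: order_tendstoD)
        then have "eventually (\<lambda>n. 0 = real (Suc n) * (w (T n) x - w 1 x)) sequentially"
          by eventually_elim (use less in \<open>simp add: w_def\<close>)
        then have "(\<lambda>n. real (Suc n) * (w (T n) x - w 1 x)) \<longlonglongrightarrow> 0"
          by (rule Lim_transform_eventually[OF tendsto_const])
        with False show ?thesis by (simp add: indicator_def)
      qed
      then show "(\<lambda>n. real (Suc n) * (w (T n) x - w 1 x) * f x) \<longlonglongrightarrow>
          - real N * indicator (ball 0 r) x * f x"
        by (rule tendsto_mult_right)
    qed
  qed
  moreover have "real (Suc n) * (J (T n) - J 1) = (LINT x|lborel. real (Suc n) * (w (T n) x - w 1 x) * f x)" for n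
  proof -
    have "J (T n) - J 1 = (LINT x|lborel. w (T n) x * f x - w 1 x * f x)"
      using T[of n] int by (simp add: J_scaled less_imp_le)
    then show ?thesis by (simp add: left_diff_distrib mult.assoc del: of_nat_Suc)
  qed
  ultimately have "(LINT x|lborel. w 1 x * (x \<bullet> grad f x)) =
      (LINT x|lborel. - real N * indicator (ball 0 r) x * f x)"
    using lim1 by (intro LIMSEQ_unique) simp_all
  then show ?thesis by (simp add: w_def N_def mult.assoc)
qed

section \<open>The radial barrier\<close>

text \<open>The product splits into \<open>(|a|^(p-1) - |b|^(p-1)) (|a| - |b|)\<close> and a
  Cauchy-Schwarz defect with nonnegative weight. The first is positive for unequal norms; for equal
  norms the defect is half of \<open>|a - b|^2\<close>.\<close>

lemma flux_strictly_monotone: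
  fixes a b :: "'a::euclidean_space"
  assumes p: "1 < p" and "a \<noteq> b"
  shows "0 < (flux p a - flux p b) \<bullet> (a - b)"
proof -
  define s where "s = norm a powr (p - 2)"
  define t where "t = norm b powr (p - 2)"
  have nn: "0 \<le> s" "0 \<le> t" by (simp_all add: s_def t_def)
  have s: "s * norm a = norm a powr (p - 1)" and t: "t * norm b = norm b powr (p - 1)"
    using norm_flux[OF p, of a] norm_flux[OF p, of b] by (simp_all add: flux_def s_def t_def)
  have eq: "(flux p a - flux p b) \<bullet> (a - b) =
      (s * norm a - t * norm b) * (norm a - norm b) + (s + t) * (norm a * norm b - a \<bullet> b)"
    by (simp add: flux_def inner_diff_left inner_diff_right inner_commute algebra_simps
        flip: s_def t_def power2_norm_eq_inner power2_eq_square)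
  have cs: "0 \<le> norm a * norm b - a \<bullet> b" using norm_cauchy_schwarz[of a b] by simp
  show ?thesis
  proof (cases "norm a = norm b")
    case False
    have "0 < (s * norm a - t * norm b) * (norm a - norm b)"
    proof (cases "norm a < norm b")
      case True
      then have "s * norm a < t * norm b"
        unfolding s t using p by (intro powr_less_mono2) auto
      with True show ?thesis by (simp add: mult_neg_neg)
    next
      case False
      with \<open>norm a \<noteq> norm b\<close> have "norm b < norm a" by simp
      moreover from this have "t * norm b < s * norm a"
        unfolding s t using p by (intro powr_less_mono2) auto
      ultimately show ?thesis by simp
    qed
    with eq cs nn show ?thesis by (simp add: add_pos_nonneg)
  next
    case True
    with \<open>a \<noteq> b\<close> have "a \<noteq> 0" by auto
    then have "0 < s" by (simp add: s_def)
    have "0 < (norm (a - b))\<^sup>2" using \<open>a \<noteq> b\<close> by simp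
    also have "(norm (a - b))\<^sup>2 = 2 * (norm a * norm b - a \<bullet> b)"
    proof -
      have "norm a * norm b = a \<bullet> a" "b \<bullet> b = a \<bullet> a"
        using True by (simp_all add: dot_square_norm power2_eq_square)
      then show ?thesis
        by (simp add: power2_norm_eq_inner inner_diff_left inner_diff_right inner_commute)
    qed
    finally have "0 < norm a * norm b - a \<bullet> b" by simp
    with eq True \<open>0 < s\<close> nn show ?thesis by (simp add: add_pos_nonneg)
  qed
qed

section \<open>Powers of the norm and gluing of derivatives\<close>

lemma GDERIV_norm_powr:
  fixes x :: "'a::euclidean_space"
  assumes "x \<noteq> 0"
  shows "GDERIV (\<lambda>x. norm x powr a) x :> (a * norm x powr (a - 2)) *\<^sub>R x"
proof -
  have "DERIV (\<lambda>s. s powr a) (norm x) :> a * norm x powr (a - 1)"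
    using assms by (intro has_real_derivative_powr) simp
  with GDERIV_norm[OF assms] have "GDERIV (\<lambda>x. norm x powr a) x :> (a * norm x powr (a - 1)) *\<^sub>R sgn x"
    by (rule GDERIV_DERIV_compose)
  moreover have "norm x powr (a - 1) = norm x powr (a - 2) * norm x"
    using powr_add[of "norm x" "a - 2" 1] assms by simp
  ultimately show ?thesis using assms by (simp add: sgn_div_norm mult.assoc)
qed

lemma GDERIV_norm_powr_zero:
  assumes "1 < a"
  shows "GDERIV (\<lambda>x::'a::euclidean_space. norm x powr a) 0 :> 0"
proof -
  have "((\<lambda>h::'a. norm h powr (a - 1)) \<longlongrightarrow> norm (0::'a) powr (a - 1)) (at 0)"
    using assms by (intro tendsto_powr' tendsto_intros) auto
  then have "((\<lambda>h::'a. norm h powr (a - 1)) \<longlongrightarrow> 0) (at 0)" using assms by simp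
  moreover have "norm h powr (a - 1) = norm h powr a / norm h" for h :: 'a
    by (cases "h = 0") (simp_all add: powr_diff)
  ultimately have "((\<lambda>h::'a. norm h powr a / norm h) \<longlongrightarrow> 0) (at 0)" by simp
  then show ?thesis by (simp add: gderiv_def has_derivative_at)
qed

text \<open>Each difference quotient of \<open>h\<close> is one of the two given ones, hence
  dominated by their sum. This handles the sphere where the branches of the barrier meet.\<close>

lemma GDERIV_glue:
  fixes f g h :: "'a::euclidean_space \<Rightarrow> real"
  assumes "GDERIV f x :> D" and "GDERIV g x :> D" and "f x = h x" and "g x = h x"
    and h: "\<And>y. h y = f y \<or> h y = g y"
  shows "GDERIV h x :> D"
  unfolding gderiv_def has_derivative_at
proof
  let ?q = "\<lambda>k v. norm (k (x + v) - k x - v \<bullet> D) / norm v"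
  have "(?q f \<longlongrightarrow> 0) (at 0)" "(?q g \<longlongrightarrow> 0) (at 0)"
    using assms(1,2) by (simp_all add: gderiv_def has_derivative_at)
  from tendsto_add[OF this] have "((\<lambda>v. ?q f v + ?q g v) \<longlongrightarrow> 0) (at 0)" by simp
  then show "(?q h \<longlongrightarrow> 0) (at 0)"
  proof (rule Lim_null_comparison[rotated])
    have "norm (?q h v) \<le> ?q f v + ?q g v" for v
      using h[of "x + v"] assms(3,4) by (elim disjE) simp_all
    then show "eventually (\<lambda>v. norm (?q h v) \<le> ?q f v + ?q g v) (at 0)" by simp
  qed
qed (rule bounded_linear_inner_left)

text \<open>At distance \<open>s \<ge> r\<close> the prescribed flux forces a gradient of norm
  \<open>((A / N) r^N s^(1 - N))^(1 / (p - 1))\<close>. Its integral from \<open>s\<close> to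
  infinity converges because \<open>p < N\<close>, and this is the coefficient of
  \<open>s^((p - N) / (p - 1))\<close> in it.\<close>

definition barrier_coeff :: "real \<Rightarrow> real \<Rightarrow> real \<Rightarrow> real \<Rightarrow> real" where
  "barrier_coeff N p A r =
    (A / N) powr (1 / (p - 1)) * ((p - 1) / (N - p)) * r powr (N / (p - 1))"

text \<open>In the ball, the value on the sphere plus the integral of
  \<open>((A / N) s)^(1 / (p - 1))\<close> from \<open>norm x\<close> to \<open>r\<close>.\<close>

definition barrier :: "real \<Rightarrow> real \<Rightarrow> real \<Rightarrow> 'a::euclidean_space \<Rightarrow> real" where
  "barrier p A r x = (let N = real DIM('a); C = barrier_coeff N p A r in
    if norm x \<le> r
    then C * r powr ((p - N) / (p - 1))
      + (A / N) powr (1 / (p - 1)) * ((p - 1) / p) * (r powr (p / (p - 1)) - norm x powr (p / (p - 1)))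
    else C * norm x powr ((p - N) / (p - 1)))"

text \<open>The factor with \<open>max\<close> equals 1 in the ball and carries the extra decay
  outside, so a single formula covers both regions.\<close>

definition barrier_grad :: "real \<Rightarrow> real \<Rightarrow> real \<Rightarrow> 'a::euclidean_space \<Rightarrow> 'a" where
  "barrier_grad p A r x = (let N = real DIM('a) in
    - ((A / N) powr (1 / (p - 1)) * (r / max r (norm x)) powr (N / (p - 1))
      * norm x powr (1 / (p - 1) - 1)) *\<^sub>R x)"

lemma GDERIV_barrier:
  fixes x :: "'a::euclidean_space"
  assumes p: "1 < p" "p < real DIM('a)" and A: "0 < A" and r: "0 < r"
  shows "GDERIV (barrier p A r) x :> barrier_grad p A r x"
proof -
  define N where "N = real DIM('a)"
  define C where "C = barrier_coeff N p A r"
  define k where "k = (A / N) powr (1 / (p - 1))"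
  define q where "q = 1 / (p - 1)"
  define c where "c = C * r powr ((p - N) / (p - 1))"
  define inn where "inn x = c + k * ((p - 1) / p) * (r powr (p / (p - 1)) - norm x powr (p / (p - 1)))"
    for x :: 'a
  define out where "out x = C * norm x powr ((p - N) / (p - 1))" for x :: 'a
  have barrier: "barrier p A r = (\<lambda>x. if norm x \<le> r then inn x else out x)"
    by (rule ext) (simp add: barrier_def inn_def out_def N_def C_def c_def k_def Let_def)
  have grad: "barrier_grad p A r x = - (k * (r / max r (norm x)) powr (N * q) * norm x powr (q - 1)) *\<^sub>R x"
    for x :: 'a
    by (simp add: barrier_grad_def Let_def N_def k_def q_def)
  have e1: "p / (p - 1) - 2 = q - 1" "(p - 1) / p * (p / (p - 1)) = 1"
    using p by (simp_all add: q_def field_simps)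
  have inn: "GDERIV inn x :> - (k * norm x powr (q - 1)) *\<^sub>R x" for x
  proof -
    have "GDERIV (\<lambda>x. norm x powr (p / (p - 1))) x :> ((p / (p - 1)) * norm x powr (p / (p - 1) - 2)) *\<^sub>R x"
    proof (cases "x = 0")
      case True
      have "1 < p / (p - 1)" using p by simp
      from GDERIV_norm_powr_zero[OF this] True show ?thesis by simp
    qed (rule GDERIV_norm_powr)
    moreover have "DERIV (\<lambda>s. c + k * ((p - 1) / p) * (r powr (p / (p - 1)) - s)) t :> - (k * ((p - 1) / p))" for t
      using p by (auto intro!: derivative_eq_intros)
    ultimately have "GDERIV inn x :> (- (k * ((p - 1) / p))) *\<^sub>R ((p / (p - 1)) * norm x powr (p / (p - 1) - 2)) *\<^sub>R x"
      unfolding inn_def by (rule GDERIV_DERIV_compose)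
    also have "(- (k * ((p - 1) / p))) *\<^sub>R ((p / (p - 1)) * norm x powr (p / (p - 1) - 2)) *\<^sub>R x =
        - (k * ((p - 1) / p * (p / (p - 1))) * norm x powr (p / (p - 1) - 2)) *\<^sub>R x"
      by (simp only: scaleR_scaleR minus_mult_left mult.assoc)
    finally show ?thesis unfolding e1 using p by simp
  qed
  \<comment> \<open>The factor \<open>(p - 1) / (N - p)\<close> of \<open>C\<close> cancels the
    exponent brought down by differentiation, up to the sign.\<close>
  have e2: "C * ((p - N) / (p - 1)) = - (k * r powr (N * q))"
  proof -
    have "(p - 1) / (N - p) * ((p - N) / (p - 1)) = (p - N) / (N - p)"
      using p by simp
    also have "\<dots> = - 1" using p by (simp add: N_def divide_eq_eq)
    finally have eq: "(p - 1) / (N - p) * ((p - N) / (p - 1)) = - 1" .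
    have "C * ((p - N) / (p - 1)) =
        k * r powr (N * q) * ((p - 1) / (N - p) * ((p - N) / (p - 1)))"
      by (simp add: C_def barrier_coeff_def k_def q_def)
    then show ?thesis unfolding eq by simp
  qed
  have e3: "(p - N) / (p - 1) - 2 = q - 1 - N * q"
  proof -
    have "p * q = 1 + q" using p by (simp add: q_def field_simps)
    moreover have "(p - N) / (p - 1) = p * q - N * q" by (simp add: q_def diff_divide_distrib)
    ultimately show ?thesis by simp
  qed
  have out: "GDERIV out x :> barrier_grad p A r x" if "r \<le> norm x" for x
  proof -
    have x: "0 < norm x" using that r by linarith
    have "GDERIV out x :> C *\<^sub>R (((p - N) / (p - 1)) * norm x powr ((p - N) / (p - 1) - 2)) *\<^sub>R x"
      unfolding out_def using x
      by (intro GDERIV_DERIV_compose[OF GDERIV_norm_powr]) (auto intro!: derivative_eq_intros)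
    also have "C *\<^sub>R (((p - N) / (p - 1)) * norm x powr ((p - N) / (p - 1) - 2)) *\<^sub>R x =
        (C * ((p - N) / (p - 1)) * norm x powr (q - 1 - N * q)) *\<^sub>R x"
      by (simp add: e3)
    also have "\<dots> = barrier_grad p A r x"
      unfolding e2 grad using that x r by (simp add: max_def powr_divide powr_diff)
    finally show ?thesis .
  qed
  have inn': "GDERIV inn x :> barrier_grad p A r x" if "norm x \<le> r" for x
    using inn[of x] that r by (simp add: grad)
  consider "norm x < r" | "norm x = r" | "r < norm x" by linarith
  then show ?thesis
  proof cases
    case 1
    have "GDERIV inn x :> barrier_grad p A r x" using inn' 1 by simp
    then show ?thesis unfolding gderiv_def barrier
      by (rule has_derivative_transform_within_open[where s="ball 0 r"]) (use 1 in auto)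
  next
    case 2
    then have "inn x = out x" by (simp add: inn_def out_def c_def)
    then show ?thesis
      unfolding barrier by (intro GDERIV_glue[OF inn' out]) (use 2 in auto)
  next
    case 3
    have "GDERIV out x :> barrier_grad p A r x" using out 3 by simp
    then show ?thesis unfolding gderiv_def barrier
      by (rule has_derivative_transform_within_open[where s="- cball 0 r"]) (use 3 in auto)
  qed
qed

text \<open>The power \<open>p - 1\<close> undoes the exponent \<open>1 / (p - 1)\<close>, leaving
  the field from which the barrier was designed.\<close>

lemma flux_barrier_grad:
  fixes x :: "'a::euclidean_space"
  assumes p: "1 < p" and A: "0 < A" and r: "0 < r"
  shows "flux p (barrier_grad p A r x) =
    (- (A / real DIM('a))) *\<^sub>R ((r / max r (norm x)) ^ DIM('a) *\<^sub>R x)"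
proof (cases "x = 0")
  case True
  then show ?thesis by (simp add: flux_def barrier_grad_def)
next
  case False
  define N where "N = real DIM('a)"
  have N: "0 < N" by (simp add: N_def)
  define q where "q = 1 / (p - 1)"
  have q: "q * (p - 1) = 1" using p by (simp add: q_def)
  define m where "m = r / max r (norm x)"
  have m: "0 < m" using r by (simp add: m_def)
  define s where "s = (A / N) powr q * m powr (N * q) * norm x powr (q - 1)"
  have s: "0 < s" using A N m False by (simp add: s_def)
  have grad: "barrier_grad p A r x = - s *\<^sub>R x"
    by (simp add: barrier_grad_def Let_def s_def N_def q_def m_def)
  have "s * norm x = (A / N) powr q * m powr (N * q) * norm x powr q"
    using False by (simp add: s_def powr_diff)
  also have "\<dots> powr (p - 1) = A / N * m powr N * norm x"
    using A N m False q by (simp add: powr_mult powr_powr mult.assoc)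
  also have "m powr N = m ^ DIM('a)"
    using m by (simp add: N_def powr_realpow)
  finally have "(s * norm x) powr (p - 1) = A / N * m ^ DIM('a) * norm x" .
  then have "(s * norm x) powr (p - 2) * (s * norm x) = A / N * m ^ DIM('a) * norm x"
    using s False powr_add[of "s * norm x" "p - 2" 1] by simp
  then have "((s * norm x) powr (p - 2) * s) * norm x = (A / N * m ^ DIM('a)) * norm x"
    by (simp only: mult.assoc)
  then have "(s * norm x) powr (p - 2) * s = A / N * m ^ DIM('a)"
    by (rule mult_right_cancel[THEN iffD1, rotated]) (use False in simp)
  then show ?thesis
    using s by (simp add: flux_def grad abs_mult flip: m_def N_def)
qed

text \<open>For \<open>p > 2\<close> the exponent \<open>1 / (p - 1) - 1\<close> is negative;
  continuity at the origin comes from the norm of the whole product, which contains the positive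
  power \<open>1 / (p - 1)\<close>.\<close>

lemma continuous_barrier_grad:
  assumes p: "1 < p" and r: "0 < r"
  shows "continuous_on UNIV (barrier_grad p A r :: 'a::euclidean_space \<Rightarrow> 'a)"
proof -
  define N where "N = real DIM('a)"
  define q where "q = 1 / (p - 1)"
  have q: "0 < q" using p by (simp add: q_def)
  define k where "k x = (A / N) powr q * (r / max r (norm x)) powr (N * q)" for x :: 'a
  have eq: "barrier_grad p A r = (\<lambda>x::'a. - (k x * norm x powr (q - 1)) *\<^sub>R x)"
    by (rule ext) (simp add: barrier_grad_def Let_def k_def N_def q_def)
  have max: "max r (norm x) \<noteq> 0" for x :: 'a using r by (smt (verit) max.cobounded1)
  then have k: "isCont k x" for x
    unfolding k_def using r by (intro continuous_intros) auto
  have "isCont (\<lambda>x::'a. - (k x * norm x powr (q - 1)) *\<^sub>R x) x" for x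
  proof (cases "x = 0")
    case False
    then show ?thesis using k by (intro continuous_intros) auto
  next
    case True
    have "((\<lambda>x::'a. norm x powr q) \<longlongrightarrow> norm (0::'a) powr q) (at 0)"
      using q by (intro tendsto_powr' tendsto_norm tendsto_ident_at tendsto_const) auto
    with k[of 0] have "((\<lambda>x::'a. k x * norm x powr q) \<longlongrightarrow> k 0 * norm (0::'a) powr q) (at 0)"
      unfolding isCont_def by (rule tendsto_mult)
    then have "((\<lambda>x::'a. k x * norm x powr q) \<longlongrightarrow> 0) (at 0)" using q by simp
    moreover have "norm (- (k x * norm x powr (q - 1)) *\<^sub>R x) = k x * norm x powr q" for x :: 'a
      by (cases "x = 0") (auto simp: k_def powr_diff abs_mult)
    ultimately have "((\<lambda>x::'a. norm (- (k x * norm x powr (q - 1)) *\<^sub>R x)) \<longlongrightarrow> 0) (at 0)"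
      by simp
    then have "((\<lambda>x::'a. - (k x * norm x powr (q - 1)) *\<^sub>R x) \<longlongrightarrow> 0) (at 0)"
      by (rule tendsto_norm_zero_cancel)
    with True show ?thesis by (simp add: isCont_def)
  qed
  then show ?thesis unfolding eq by (simp add: continuous_at_imp_continuous_on)
qed

section \<open>Comparison\<close>

lemma C1_barrier:
  fixes A :: real
  assumes "1 < p" "p < real DIM('a::euclidean_space)" "0 < A" "0 < r"
  shows "C1 (barrier p A r :: 'a \<Rightarrow> real)"
    and "grad (barrier p A r :: 'a \<Rightarrow> real) = barrier_grad p A r"
  using C1I[OF GDERIV_barrier[OF assms] continuous_barrier_grad[OF assms(1,4)]] by blast+

text \<open>The dimension produced by the divergence cancels the one in \<open>A / N\<close>. The
  barrier thus satisfies the weak equation with equality, for test functions of any sign.\<close>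

lemma LINT_flux_barrier_grad:
  fixes f :: "'a::euclidean_space \<Rightarrow> real"
  assumes "1 < p" "0 < A" "0 < r" "C1 f" "compact K" "\<And>x. x \<notin> K \<Longrightarrow> f x = 0"
  shows "(LINT x|lborel. flux p (barrier_grad p A r x) \<bullet> grad f x) =
    A * (LINT x|lborel. indicator (ball 0 r) x * f x)"
proof -
  have "(LINT x|lborel. flux p (barrier_grad p A r x) \<bullet> grad f x) =
    - (A / real DIM('a)) * (LINT x|lborel. ((r / max r (norm x)) ^ DIM('a) *\<^sub>R x) \<bullet> grad f x)"
    unfolding flux_barrier_grad[OF assms(1-3)] inner_scaleR_left[of "- (A / real DIM('a))"]
    by (rule integral_mult_right_zero)
  also have "\<dots> = A * (LINT x|lborel. indicator (ball 0 r) x * f x)"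
    using divergence_radial_field[OF assms(4-6,3)] by simp
  finally show ?thesis .
qed

lemma barrier_small_outside:
  assumes p: "1 < p" "p < real DIM('a::euclidean_space)" and "0 < e"
  obtains R where "\<And>x::'a. R < norm x \<Longrightarrow> barrier p A r x < e"
proof -
  define N where "N = real DIM('a)"
  have "((\<lambda>s. s powr ((p - N) / (p - 1))) \<longlongrightarrow> 0) at_top"
    using p by (intro tendsto_neg_powr filterlim_ident) (simp add: N_def divide_neg_pos)
  then have "((\<lambda>s. barrier_coeff N p A r * s powr ((p - N) / (p - 1))) \<longlongrightarrow> 0) at_top"
    by (rule tendsto_mult_right_zero)
  then have "eventually (\<lambda>s. barrier_coeff N p A r * s powr ((p - N) / (p - 1)) < e) at_top"
    using \<open>0 < e\<close> by (rule order_tendstoD)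
  then obtain S where S: "\<And>s. S \<le> s \<Longrightarrow> barrier_coeff N p A r * s powr ((p - N) / (p - 1)) < e"
    unfolding eventually_at_top_linorder by blast
  have "barrier p A r x < e" if "max S r < norm x" for x :: 'a
    using S[of "norm x"] that by (simp add: barrier_def Let_def N_def)
  then show thesis by (rule that)
qed

text \<open>A weak comparison principle in which decay at infinity takes the place of boundary
  values.\<close>

lemma barrier_le:
  fixes u :: "'a::euclidean_space \<Rightarrow> real"
  assumes p: "1 < p" "p < real DIM('a)" and A: "0 < A" and r: "0 < r" and u: "C1 u" "\<And>x. 0 \<le> u x"
    and ball: "weak_minus_p_Laplacian_ge p u (\<lambda>_. A) (ball 0 r)"
    and global: "weak_minus_p_Laplacian_ge p u (\<lambda>_. 0) UNIV"
  shows "barrier p A r x \<le> u x"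
proof (rule field_le_epsilon)
  fix e :: real assume e: "0 < e"
  let ?v = "barrier p A r :: 'a \<Rightarrow> real"
  note v = C1_barrier[OF p A r]
  define w where "w x = ?v x - u x - e" for x
  have w_GDERIV: "GDERIV w x :> grad ?v x - grad u x" for x
    unfolding w_def using GDERIV_diff[OF GDERIV_diff[OF C1_GDERIV[OF v(1)] C1_GDERIV[OF u(1)]] GDERIV_const]
    by simp
  have w: "C1 w" "grad w = (\<lambda>x. grad ?v x - grad u x)"
    using C1I[OF w_GDERIV] by (simp_all add: continuous_on_diff C1_continuous_grad u v(1))
  define f where "f x = (max 0 (w x))\<^sup>2" for x
  have f: "C1 f"
    unfolding f_def by (rule C1_compose[OF w(1) DERIV_pos_part_square]) (intro continuous_intros)
  have grad_f: "grad f x = (2 * max 0 (w x)) *\<^sub>R (grad ?v x - grad u x)" for x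
    unfolding f_def using GDERIV_compose[OF w(1) DERIV_pos_part_square]
    by (simp add: grad_eqI w(2))
  obtain R where R: "\<And>x::'a. R < norm x \<Longrightarrow> ?v x < e"
    using barrier_small_outside[OF p e] by blast
  have K: "compact (cball (0::'a) R)" by (rule compact_cball)
  have zero: "f x = 0" if "x \<notin> cball 0 R" for x
    using R[of x] u(2)[of x] that by (simp add: f_def w_def max_def)
  have grad_zero: "grad f x = 0" if "x \<notin> cball 0 R" for x
    using grad_zero_outside[OF zero closed_cball that] .
  have cont_flux: "continuous_on UNIV (\<lambda>x. flux p (grad g x))" if "C1 g" for g :: "'a \<Rightarrow> real"
    by (rule continuous_on_compose2[OF continuous_on_flux[OF p(1)] C1_continuous_grad[OF that]]) simp
  have cont: "continuous_on UNIV (\<lambda>x. flux p (grad g x) \<bullet> grad f x)" if "C1 g" for g :: "'a \<Rightarrow> real"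
    by (intro continuous_on_inner cont_flux that C1_continuous_grad f)
  have int: "integrable lborel (\<lambda>x. flux p (grad g x) \<bullet> grad f x)" if "C1 g" for g :: "'a \<Rightarrow> real"
    by (rule integrable_continuous_compact_support[OF cont[OF that] K]) (simp add: grad_zero)
  have "A * (LINT x|lborel. indicator (ball 0 r) x * f x) \<le> (LINT x|lborel. flux p (grad u x) \<bullet> grad f x)"
  proof (rule weak_inequality_indicator[OF cont_flux[OF u(1)] _ _ f _ K zero r])
    fix g :: "'a \<Rightarrow> real" and L
    assume g: "C1 g" "\<And>x. 0 \<le> g x" "compact L" "\<And>x. x \<notin> L \<Longrightarrow> g x = 0"
    show "A * (LINT x|lborel. g x) \<le> (LINT x|lborel. flux p (grad u x) \<bullet> grad g x)" if "L \<subseteq> ball 0 r"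
      using weak_minus_p_Laplacian_ge_C1[OF ball p(1) u(1) open_ball g(1-3) that g(4)] .
    show "0 \<le> (LINT x|lborel. flux p (grad u x) \<bullet> grad g x)"
      using weak_minus_p_Laplacian_ge_C1[OF global p(1) u(1) open_UNIV g(1-3) subset_UNIV g(4)] by simp
  qed (simp add: f_def)
  \<comment> \<open>The equality for the barrier meets the inequality for \<open>u\<close>: their
    difference has the sign opposite to the one given by monotonicity.\<close>
  also have "A * (LINT x|lborel. indicator (ball 0 r) x * f x) =
      (LINT x|lborel. flux p (grad ?v x) \<bullet> grad f x)"
    using LINT_flux_barrier_grad[OF p(1) A r f K zero] by (simp add: v(2))
  finally have le: "(LINT x|lborel. (flux p (grad ?v x) - flux p (grad u x)) \<bullet> grad f x) \<le> 0"
    using int[OF v(1)] int[OF u(1)] by (simp add: inner_diff_left)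
  have integrand: "(flux p (grad ?v x) - flux p (grad u x)) \<bullet> grad f x =
      2 * max 0 (w x) * ((flux p (grad ?v x) - flux p (grad u x)) \<bullet> (grad ?v x - grad u x))" for x
    by (simp only: grad_f inner_scaleR_right)
  have mono: "0 \<le> (flux p a - flux p b) \<bullet> (a - b)" for a b :: 'a
    using flux_strictly_monotone[OF p(1), of a b] by (cases "a = b") auto
  have int0: "(flux p (grad ?v x) - flux p (grad u x)) \<bullet> grad f x = 0" for x
  proof (rule LINT_zero_imp_zero[OF _ K _ _ le])
    show "continuous_on UNIV (\<lambda>x. (flux p (grad ?v x) - flux p (grad u x)) \<bullet> grad f x)"
      unfolding inner_diff_left by (intro continuous_on_diff cont u(1) v(1))
    show "0 \<le> (flux p (grad ?v x) - flux p (grad u x)) \<bullet> grad f x" for x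
      unfolding integrand by (intro mult_nonneg_nonneg mono) simp_all
  qed (simp add: grad_zero)
  \<comment> \<open>Where the two gradients agree, \<open>grad f\<close> has a zero factor; where
    they differ, strict monotonicity and the vanishing integrand force
    \<open>max 0 (w x) = 0\<close>.\<close>
  have "grad f x = 0" for x
  proof (cases "grad ?v x = grad u x")
    case True
    then show ?thesis by (simp add: grad_f)
  next
    case False
    from flux_strictly_monotone[OF p(1) this] int0[of x] have "max 0 (w x) = 0"
      unfolding integrand by simp
    then show ?thesis by (simp add: grad_f)
  qed
  then have "(f has_derivative (\<lambda>_. 0)) (at x within UNIV)" for x
    using C1_GDERIV[OF f, of x] by (simp add: gderiv_def)
  then obtain c where c: "\<And>x. f x = c"
    using has_derivative_zero_constant[of UNIV f] by auto
  \<comment> \<open>A point outside the ball fixes the constant as 0. The \<open>max\<close>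
    provides an admissible norm even when \<open>R\<close> is negative.\<close>
  obtain y :: 'a where "norm y = max 0 (R + 1)"
    using vector_choose_size[of "max 0 (R + 1)"] by auto
  then have "c = 0" using zero[of y] c[of y] by simp
  with c[of x] have "w x \<le> 0" by (simp add: f_def max_def split: if_splits)
  then show "?v x \<le> u x + e" by (simp add: w_def)
qed

theorem proposition5p2:
  fixes u :: "real ^ 'n \<Rightarrow> real" and p A r \<alpha> C N :: real
  defines "N \<equiv> real CARD('n)"
  defines "C \<equiv> (A / N) powr (1 / (p - 1)) * ((p - 1) / (N - p)) * r powr (N / (p - 1))"
  assumes "1 < p" and "p < N" and "A > 0" and "r > 0" and "\<alpha> > 0"
    and "u \<in> D1p p \<inter> C1_loc \<alpha>"
    and "weak_minus_p_Laplacian_ge p u (\<lambda>_. A) (ball 0 r)"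
    and "weak_minus_p_Laplacian_ge p u (\<lambda>_. 0) UNIV"
    and "\<forall>x. u x \<ge> 0"
  shows "\<forall>x. norm x > r \<longrightarrow> u x \<ge> C * norm x powr ((p - N) / (p - 1))"
proof (intro allI impI)
  fix x :: "real ^ 'n" assume x: "norm x > r"
  have "C1 u" using assms(8) by (simp add: C1_loc_def C1_def)
  then have "barrier p A r x \<le> u x"
    using assms by (intro barrier_le) (simp_all add: N_def)
  with x show "u x \<ge> C * norm x powr ((p - N) / (p - 1))"
    by (simp add: barrier_def barrier_coeff_def C_def N_def Let_def)
qed

end
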